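(* Let $n\ge 2$, let $V$ be an $n$-dimensional complex vector space with orthonormal basis $e_1,\ldots,e_n$ for a nondegenerate symmetric bilinear form, $a_{ij}=e_i\wedge e_j\in\Lambda_2(V)$, and $A=(a_{ij})_{1\le i,j\le n}\in\operatorname{Mat}_{n,n}(\Lambda(\Lambda_2(V)))$. Then $$(n-2)A^{2n-3}-\sum_{0\le k\le m-2}\operatorname{tr}(A^{4k+3})A^{2n-3-4k-3}=0\qquad\text{if } n=2m,$$ $$nA^{2n-3}-\sum_{0\le k\le m-1}\operatorname{tr}(A^{4k+3})A^{2n-3-4k-3}=0\qquad\text{if } n=2m+1.$$
   Context: $\Lambda(\Lambda_2(V))$ is the exterior algebra on $\Lambda_2(V)$; its products are exterior products, and matrix products are taken with entries multiplied in the order written; $A^0$ is the identity matrix. *)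

theory Defs
  imports Complex_Main
begin

text \<open>Concrete model of the exterior algebra over the complex numbers on
Lambda_2(V), dim V = n.  A basis of Lambda_2(V) is a_{ij} = e_i wedge e_j, i < j,
indexed by pairs (i,j).  An element of the exterior algebra is represented by its
coefficient function on finite sets S of basis indices (coefficient of the
monomial e_S, the factors of e_S taken in increasing lexicographic order).\<close>

type_synonym ext = "(nat \<times> nat) set \<Rightarrow> complex"

definition pair_less :: "nat \<times> nat \<Rightarrow> nat \<times> nat \<Rightarrow> bool" where
  "pair_less p q \<longleftrightarrow> fst p < fst q \<or> (fst p = fst q \<and> snd p < snd q)"

text \<open>Sign of e_T wedge e_U = sign * e_(T union U) for disjoint T, U.\<close>
definition wedge_sign :: "(nat \<times> nat) set \<Rightarrow> (nat \<times> nat) set \<Rightarrow> complex" where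
  "wedge_sign T U = (-1) ^ card {(t, u). t \<in> T \<and> u \<in> U \<and> pair_less u t}"

definition ext_zero :: ext where "ext_zero = (\<lambda>S. 0)"
definition ext_one :: ext where "ext_one = (\<lambda>S. if S = {} then 1 else 0)"
definition ext_add :: "ext \<Rightarrow> ext \<Rightarrow> ext" where "ext_add x y = (\<lambda>S. x S + y S)"
definition ext_diff :: "ext \<Rightarrow> ext \<Rightarrow> ext" where "ext_diff x y = (\<lambda>S. x S - y S)"
definition ext_smul :: "complex \<Rightarrow> ext \<Rightarrow> ext" where "ext_smul c x = (\<lambda>S. c * x S)"
definition ext_sum :: "('i \<Rightarrow> ext) \<Rightarrow> 'i set \<Rightarrow> ext" where
  "ext_sum f K = (\<lambda>S. \<Sum>k\<in>K. f k S)"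

definition ext_mult :: "ext \<Rightarrow> ext \<Rightarrow> ext" where
  "ext_mult x y = (\<lambda>S. if finite S
      then \<Sum>T\<in>Pow S. wedge_sign T (S - T) * x T * y (S - T) else 0)"

definition ext_gen :: "nat \<Rightarrow> nat \<Rightarrow> ext" where
  "ext_gen i j = (if i < j then (\<lambda>S. if S = {(i, j)} then 1 else 0)
                  else if j < i then (\<lambda>S. if S = {(j, i)} then -1 else 0)
                  else ext_zero)"

text \<open>n x n matrices over the exterior algebra, indices 0..n-1.\<close>
type_synonym emat = "nat \<Rightarrow> nat \<Rightarrow> ext"

definition emat_A :: emat where "emat_A = (\<lambda>i j. ext_gen i j)"

definition emat_id :: emat where "emat_id = (\<lambda>i j. if i = j then ext_one else ext_zero)"

definition emat_mult :: "nat \<Rightarrow> emat \<Rightarrow> emat \<Rightarrow> emat" where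
  "emat_mult n M N = (\<lambda>i j. ext_sum (\<lambda>k. ext_mult (M i k) (N k j)) {..<n})"

primrec emat_pow :: "nat \<Rightarrow> emat \<Rightarrow> nat \<Rightarrow> emat" where
  "emat_pow n M 0 = emat_id"
| "emat_pow n M (Suc k) = emat_mult n (emat_pow n M k) M"

definition emat_trace :: "nat \<Rightarrow> emat \<Rightarrow> ext" where
  "emat_trace n M = ext_sum (\<lambda>i. M i i) {..<n}"

end

theory Submission
  imports Defs
begin

text \<open>
  Adjoin to the generators a_ij of the exterior algebra further odd generators theta_0, ...,
  theta_{n-1} and e1, e2.  Since A is skew-symmetric with odd entries, A^2, e1 A and e2 A are
  skew-symmetric with even entries.  For skew-symmetric K and L with even entries put
  kappa = 1/2 sum K_ab d_a d_b and omega = 1/2 sum L_ab theta_a theta_b, where d_a is the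
  contraction with theta_a.  Commuting kappa past theta_j and d_j past omega shows that
  kappa^r (theta_j omega^r) is the linear form in theta with coefficients (r!)^2 W_r, where the
  matrices W_r arise from LK by a Faddeev-LeVerrier recursion with halved traces (this is the
  characteristic polynomial of LK up to the square root).  For K = A^2 + e1 A and L = A^2 + e2 A
  the recursion can be solved, since almost all products of traces vanish; the e1-coefficient of
  W_r is, up to sign, r A^{4r-1} - 1/2 sum_{k<r} tr(A^{4k+3}) A^{4(r-1-k)}.

  The other ingredient is the odd derivation nabla = sum eta_j d_j with eta_j = sum a_jl theta_l.
  It kills every element of top degree in theta because A has zero diagonal, it kills
  omega_0 = sum eta_j^2 (twice the quadratic form of A^2), and it maps alpha = sum eta_j theta_j
  to 2 omega_0.  For n = 2m, applying it to alpha omega_0^{m-1} gives omega_0^m = 0 (the Pfaffian of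
  A^2 vanishes), hence L W_{m-1} = 0, whose e1-coefficient is the claim.  For n = 2m+1, applying it
  to theta_k alpha omega_0^{m-1} gives eta_k alpha omega_0^{m-1} = 2 theta_k omega_0^m; applying
  kappa^m and comparing the e1 e2-coefficients gives the claim.
\<close>

section \<open>The exterior algebra as a ring\<close>

lemma pair_less_total: "p \<noteq> q \<Longrightarrow> pair_less p q \<or> pair_less q p"
  by (cases p; cases q) (auto simp: pair_less_def)

lemma pair_less_asym: "pair_less p q \<Longrightarrow> \<not> pair_less q p"
  by (auto simp: pair_less_def)

lemma finite_inversions:
  assumes "finite T" "finite U"
  shows "finite {(t, u). t \<in> T \<and> u \<in> U \<and> pair_less u t}"
  by (rule finite_subset[of _ "T \<times> U"]) (use assms in auto)

lemma wedge_sign_empty [simp]: "wedge_sign {} U = 1" "wedge_sign T {} = 1"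
  by (simp_all add: wedge_sign_def)

lemma wedge_sign_union_left:
  assumes "finite T" "finite U" "finite V" "T \<inter> U = {}"
  shows "wedge_sign (T \<union> U) V = wedge_sign T V * wedge_sign U V"
proof -
  have "{(t, v). t \<in> T \<union> U \<and> v \<in> V \<and> pair_less v t}
      = {(t, v). t \<in> T \<and> v \<in> V \<and> pair_less v t} \<union> {(t, v). t \<in> U \<and> v \<in> V \<and> pair_less v t}"
    by auto
  moreover have "{(t, v). t \<in> T \<and> v \<in> V \<and> pair_less v t} \<inter> {(t, v). t \<in> U \<and> v \<in> V \<and> pair_less v t} = {}"
    using assms(4) by auto
  ultimately show ?thesis
    using assms by (simp add: wedge_sign_def card_Un_disjoint finite_inversions power_add)
qed

lemma wedge_sign_union_right:
  assumes "finite T" "finite U" "finite V" "U \<inter> V = {}"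
  shows "wedge_sign T (U \<union> V) = wedge_sign T U * wedge_sign T V"
proof -
  have "{(t, v). t \<in> T \<and> v \<in> U \<union> V \<and> pair_less v t}
      = {(t, v). t \<in> T \<and> v \<in> U \<and> pair_less v t} \<union> {(t, v). t \<in> T \<and> v \<in> V \<and> pair_less v t}"
    by auto
  moreover have "{(t, v). t \<in> T \<and> v \<in> U \<and> pair_less v t} \<inter> {(t, v). t \<in> T \<and> v \<in> V \<and> pair_less v t} = {}"
    using assms(4) by auto
  ultimately show ?thesis
    using assms by (simp add: wedge_sign_def card_Un_disjoint finite_inversions power_add)
qed

lemma wedge_sign_square [simp]: "wedge_sign T U * wedge_sign T U = 1"
  by (simp add: wedge_sign_def)

lemma wedge_sign_square' [simp]: "wedge_sign T U * (wedge_sign T U * c) = c"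
  by (simp flip: mult.assoc)

text \<open>Every element of \<open>S\<close> lies either above or below \<open>p\<close>, so the
  inversions counted by the two signs add up to \<open>card S\<close>.\<close>

lemma wedge_sign_swap:
  assumes "finite S" "p \<notin> S"
  shows "wedge_sign S {p} = (-1) ^ card S * wedge_sign {p} S"
proof -
  let ?G = "{s \<in> S. pair_less p s}" and ?L = "{s \<in> S. pair_less s p}"
  have "?G \<union> ?L = S"
    using assms pair_less_total by (auto, metis)
  moreover have "?G \<inter> ?L = {}"
    using pair_less_asym[of p] by auto
  moreover have "card (?G \<union> ?L) = card ?G + card ?L"
    using assms calculation(2) by (intro card_Un_disjoint) auto
  ultimately have "card S = card ?G + card ?L"
    by simp
  moreover have "{(t, u). t \<in> S \<and> u \<in> {p} \<and> pair_less u t} = ?G \<times> {p}"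
    "{(t, u). t \<in> {p} \<and> u \<in> S \<and> pair_less u t} = {p} \<times> ?L"
    by auto
  ultimately show ?thesis
    by (simp add: wedge_sign_def card_cartesian_product power_add mult.assoc)
qed

lemma wedge_sign_pair:
  assumes "p \<noteq> q"
  shows "wedge_sign {p} {q} = - wedge_sign {q} {p}"
proof -
  have "wedge_sign {p} {q} = (if pair_less q p then -1 else 1)" for p q
  proof -
    have "{(t, u). t \<in> {p} \<and> u \<in> {q} \<and> pair_less u t} = (if pair_less q p then {(p, q)} else {})"
      by auto
    then show ?thesis by (simp add: wedge_sign_def)
  qed
  then show ?thesis using pair_less_total[OF assms] pair_less_asym[of p q] by auto
qed

lemma wedge_sign_insert_right:
  assumes "finite S" "q \<notin> S"
  shows "wedge_sign {p} (insert q S) = wedge_sign {p} {q} * wedge_sign {p} S"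
  using wedge_sign_union_right[of "{p}" "{q}" S] assms by simp

text \<open>The full type \<open>ext\<close> has no unit: \<open>ext_mult\<close> vanishes on
  infinite sets, so multiplying by \<open>ext_one\<close> erases the values there. The functions
  that vanish on infinite sets form a unital ring.\<close>

typedef grassmann = "{x :: ext. \<forall>S. infinite S \<longrightarrow> x S = 0}"
  morphisms coeff Abs_grassmann
  by (rule exI[of _ "\<lambda>_. 0"]) simp

setup_lifting type_definition_grassmann

lemma coeff_infinite [simp]: "infinite S \<Longrightarrow> coeff x S = 0"
  using coeff[of x] by auto

lemma grassmann_eqI: "(\<And>S. finite S \<Longrightarrow> coeff x S = coeff y S) \<Longrightarrow> x = y"
  by (metis coeff_inject coeff_infinite ext)

text \<open>Both sides run over the splittings of \<open>S\<close> into three ordered blocks.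
  Inversion counts are additive in each argument, so either sign counts the inversions between the
  three pairs of blocks.\<close>

lemma ext_mult_assoc:
  assumes "finite S"
  shows "ext_mult (ext_mult x y) z S = ext_mult x (ext_mult y z) S"
proof -
  have fin: "finite T" if "T \<subseteq> S" for T
    using assms that finite_subset by blast
  have "ext_mult (ext_mult x y) z S =
      (\<Sum>V\<in>Pow S. \<Sum>T\<in>Pow V. wedge_sign V (S - V) * wedge_sign T (V - T) * x T * y (V - T) * z (S - V))"
    using assms fin by (auto simp: ext_mult_def sum_distrib_left sum_distrib_right mult_ac intro!: sum.cong)
  also have "\<dots> = (\<Sum>(V, T)\<in>(SIGMA V:Pow S. Pow V).
      wedge_sign V (S - V) * wedge_sign T (V - T) * x T * y (V - T) * z (S - V))"
    using assms fin by (subst sum.Sigma) auto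
  also have "\<dots> = (\<Sum>(T, U)\<in>(SIGMA T:Pow S. Pow (S - T)).
      wedge_sign T (S - T) * wedge_sign U (S - T - U) * x T * y U * z (S - T - U))"
  \<comment> \<open>A splitting is given on the left by the union \<open>V\<close> of the first two
    blocks together with the first block \<open>T\<close>, on the right by the first two blocks
    themselves.\<close>
  proof (rule sum.reindex_bij_witness[where i = "\<lambda>(T, U). (T \<union> U, T)" and j = "\<lambda>(V, T). (T, V - T)"],
      goal_cases)
    case (5 VT)
    then obtain V T where VT_eq: "VT = (V, T)" and VT: "V \<subseteq> S" "T \<subseteq> V"
      by auto
    let ?U = "V - T" and ?W = "S - V"
 have eq: "T \<union> ?U = V" "S - T = ?U \<union> ?W" "S - T - ?U = ?W"
      using VT by auto
    have f: "finite T" "finite ?U" "finite ?W"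
      using VT fin assms by auto
    have "wedge_sign V ?W = wedge_sign T ?W * wedge_sign ?U ?W"
      using wedge_sign_union_left[OF f] eq(1) by auto
    moreover have "wedge_sign T (S - T) = wedge_sign T ?U * wedge_sign T ?W"
      unfolding eq(2) by (rule wedge_sign_union_right[OF f]) auto
    ultimately show ?case
      unfolding VT_eq using eq(3) by simp
  qed auto
  also have "\<dots> = (\<Sum>T\<in>Pow S. \<Sum>U\<in>Pow (S - T).
      wedge_sign T (S - T) * wedge_sign U (S - T - U) * x T * y U * z (S - T - U))"
    using assms fin by (subst sum.Sigma) auto
  also have "\<dots> = ext_mult x (ext_mult y z) S"
    using assms fin by (auto simp: ext_mult_def sum_distrib_left mult_ac intro!: sum.cong)
  finally show ?thesis .
qed

text \<open>Real scalars are enough, because all constants in the argument are rational.\<close>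

instantiation grassmann :: real_algebra_1
begin

lift_definition zero_grassmann :: grassmann is ext_zero
  by (simp add: ext_zero_def)
lift_definition one_grassmann :: grassmann is ext_one
  by (auto simp: ext_one_def)
lift_definition plus_grassmann :: "grassmann \<Rightarrow> grassmann \<Rightarrow> grassmann" is ext_add
  by (simp add: ext_add_def)
lift_definition minus_grassmann :: "grassmann \<Rightarrow> grassmann \<Rightarrow> grassmann" is ext_diff
  by (simp add: ext_diff_def)
lift_definition uminus_grassmann :: "grassmann \<Rightarrow> grassmann" is "\<lambda>x S. - x S"
  by simp
lift_definition times_grassmann :: "grassmann \<Rightarrow> grassmann \<Rightarrow> grassmann" is ext_mult
  by (simp add: ext_mult_def)
lift_definition scaleR_grassmann :: "real \<Rightarrow> grassmann \<Rightarrow> grassmann" is "\<lambda>r x S. of_real r * x S"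
  by simp

instance
proof
  fix a b c :: grassmann and r s :: real
  show "a * b * c = a * (b * c)"
    by (rule grassmann_eqI, transfer) (rule ext_mult_assoc)
  show "1 * a = a"
  proof (rule grassmann_eqI, transfer)
    fix x :: ext and S :: "(nat \<times> nat) set" assume "finite S"
    then have "ext_mult ext_one x S = (\<Sum>T\<in>Pow S. if T = {} then x S else 0)"
      by (simp only: ext_mult_def if_True) (rule sum.cong, auto simp: ext_one_def)
    with \<open>finite S\<close> show "ext_mult ext_one x S = x S" by simp
  qed
  show "a * 1 = a"
  proof (rule grassmann_eqI, transfer)
    fix x :: ext and S :: "(nat \<times> nat) set" assume "finite S"
    then have "ext_mult x ext_one S = (\<Sum>T\<in>Pow S. if T = S then x S else 0)"
      by (simp only: ext_mult_def if_True) (rule sum.cong, auto simp: ext_one_def)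
    with \<open>finite S\<close> show "ext_mult x ext_one S = x S" by simp
  qed
  show "(0::grassmann) \<noteq> 1"
    by transfer (auto simp: ext_zero_def ext_one_def fun_eq_iff)
  show "a + b + c = a + (b + c)" "a + b = b + a" "0 + a = a" "- a + a = 0" "a - b = a + - b"
    by (transfer; simp add: ext_add_def ext_diff_def ext_zero_def fun_eq_iff)+
  show "(a + b) * c = a * c + b * c" "a * (b + c) = a * b + a * c"
    by (transfer; simp add: ext_add_def ext_mult_def fun_eq_iff distrib_left distrib_right sum.distrib)+
  show "r *\<^sub>R (a + b) = r *\<^sub>R a + r *\<^sub>R b" "(r + s) *\<^sub>R a = r *\<^sub>R a + s *\<^sub>R a"
    "r *\<^sub>R s *\<^sub>R a = (r * s) *\<^sub>R a" "1 *\<^sub>R a = a"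
    by (transfer; simp add: ext_add_def fun_eq_iff algebra_simps)+
  show "r *\<^sub>R a * b = r *\<^sub>R (a * b)" "a * r *\<^sub>R b = r *\<^sub>R (a * b)"
    by (transfer; simp add: ext_mult_def fun_eq_iff sum_distrib_left mult_ac)+
qed

end

lemma coeff_simps [simp]:
  "coeff 0 S = 0"
  "coeff (x + y) S = coeff x S + coeff y S"
  "coeff (x - y) S = coeff x S - coeff y S"
  "coeff (- x) S = - coeff x S"
  "coeff (r *\<^sub>R x) S = of_real r * coeff x S"
  by (transfer; simp add: ext_zero_def ext_add_def ext_diff_def)+

lemma coeff_sum: "coeff (\<Sum>i\<in>I. f i) S = (\<Sum>i\<in>I. coeff (f i) S)"
  by (induction I rule: infinite_finite_induct) simp_all

section \<open>Generators, contractions and their anticommutation relations\<close>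

lift_definition gen :: "nat \<times> nat \<Rightarrow> grassmann" is "\<lambda>p S. if S = {p} then 1 else 0"
  by auto

text \<open>Interior product with the generator at \<open>p\<close>: the sign moves that factor to
  the front of the monomial before it is deleted.\<close>

lift_definition contract :: "nat \<times> nat \<Rightarrow> grassmann \<Rightarrow> grassmann" is
  "\<lambda>p x S. if p \<in> S then 0 else wedge_sign {p} S * x (insert p S)"
  by simp

lift_definition grade_inv :: "grassmann \<Rightarrow> grassmann" is "\<lambda>x S. (-1) ^ card S * x S"
  by simp

lemma coeff_gen_mult:
  assumes "finite S"
  shows "coeff (gen p * x) S = (if p \<in> S then wedge_sign {p} (S - {p}) * coeff x (S - {p}) else 0)"
  using assms
proof transfer
  fix p and x :: ext and S :: "(nat \<times> nat) set" assume "finite S"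
  then have "ext_mult (\<lambda>S. if S = {p} then 1 else 0) x S
      = (\<Sum>T\<in>Pow S. if T = {p} then wedge_sign {p} (S - {p}) * x (S - {p}) else 0)"
    by (simp only: ext_mult_def if_True) (rule sum.cong, auto)
  with \<open>finite S\<close> show "ext_mult (\<lambda>S. if S = {p} then 1 else 0) x S
      = (if p \<in> S then wedge_sign {p} (S - {p}) * x (S - {p}) else 0)" by simp
qed

lemma coeff_mult_gen:
  assumes "finite S"
  shows "coeff (x * gen p) S = (if p \<in> S then wedge_sign (S - {p}) {p} * coeff x (S - {p}) else 0)"
  using assms
proof transfer
  fix p and x :: ext and S :: "(nat \<times> nat) set" assume S: "finite S"
  have "ext_mult x (\<lambda>S. if S = {p} then 1 else 0) S
      = (\<Sum>T\<in>Pow S. if p \<in> S \<and> T = S - {p} then wedge_sign (S - {p}) {p} * x (S - {p}) else 0)"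
    unfolding ext_mult_def if_P[OF S]
  proof (rule sum.cong[OF refl])
    fix T assume T: "T \<in> Pow S"
    show "wedge_sign T (S - T) * x T * (if S - T = {p} then 1 else 0)
        = (if p \<in> S \<and> T = S - {p} then wedge_sign (S - {p}) {p} * x (S - {p}) else 0)"
    proof (cases "p \<in> S \<and> T = S - {p}")
      case True
      then have "S - T = {p}" by auto
      with True show ?thesis by simp
    next
      case False
      with T have "S - T \<noteq> {p}" by auto
      with False show ?thesis by (simp only: if_False mult_zero_right)
    qed
  qed
  also have "\<dots> = (if p \<in> S then wedge_sign (S - {p}) {p} * x (S - {p}) else 0)"
    using S by (cases "p \<in> S") (simp_all add: sum.delta)
  finally show "ext_mult x (\<lambda>S. if S = {p} then 1 else 0) S
      = (if p \<in> S then wedge_sign (S - {p}) {p} * x (S - {p}) else 0)" .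
qed

lemma coeff_contract:
  "coeff (contract p x) S = (if p \<in> S then 0 else wedge_sign {p} S * coeff x (insert p S))"
  by transfer simp

lemma coeff_grade_inv: "coeff (grade_inv x) S = (-1) ^ card S * coeff x S"
  by transfer simp

lemma grade_inv_grade_inv [simp]: "grade_inv (grade_inv x) = x"
  by (rule grassmann_eqI) (simp add: coeff_grade_inv mult.assoc)

lemma grade_inv_gen [simp]: "grade_inv (gen p) = - gen p"
  by (rule grassmann_eqI, simp add: coeff_grade_inv, transfer) simp

lemma grade_inv_linear [simp]:
  "grade_inv 0 = 0" "grade_inv (x + y) = grade_inv x + grade_inv y" "grade_inv (- x) = - grade_inv x"
  "grade_inv (x - y) = grade_inv x - grade_inv y" 
  by (rule grassmann_eqI, simp add: coeff_grade_inv algebra_simps)+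

lemma contract_linear [simp]:
  "contract p 0 = 0" "contract p (x + y) = contract p x + contract p y"
  "contract p (- x) = - contract p x" "contract p (x - y) = contract p x - contract p y"
  "contract p (r *\<^sub>R x) = r *\<^sub>R contract p x"
  by (rule grassmann_eqI, simp add: coeff_contract algebra_simps)+

lemma contract_sum: "contract p (\<Sum>i\<in>I. f i) = (\<Sum>i\<in>I. contract p (f i))"
  by (induction I rule: infinite_finite_induct) simp_all

lemma contract_one [simp]: "contract p 1 = 0"
  by (rule grassmann_eqI, simp add: coeff_contract, transfer) (simp add: ext_one_def)

text \<open>Moving a generator across a monomial with d factors costs (-1)^d, which is what
  \<open>grade_inv\<close> records.\<close>

lemma gen_mult_commute: "gen p * x = grade_inv x * gen p"
proof (rule grassmann_eqI)
  fix S :: "(nat \<times> nat) set" assume S: "finite S"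
  show "coeff (gen p * x) S = coeff (grade_inv x * gen p) S"
    using S wedge_sign_swap[of "S - {p}" p]
    by (simp add: coeff_gen_mult coeff_mult_gen coeff_grade_inv mult.assoc)
qed

text \<open>Together with \<open>contract_contract\<close> and \<open>gen_anticommute\<close> this
  gives the canonical anticommutation relations, on which the later computations with contractions
  rest. For distinct \<open>p\<close> and \<open>q\<close> the minus sign is that of exchanging the
  two factors.\<close>

lemma contract_gen_mult:
  "contract p (gen q * x) = (if p = q then x else 0) - gen q * contract p x"
proof (rule grassmann_eqI)
  fix S :: "(nat \<times> nat) set" assume S: "finite S"
  show "coeff (contract p (gen q * x)) S = coeff ((if p = q then x else 0) - gen q * contract p x) S"
  proof (cases "p = q")
    case True
    with S show ?thesis
      by (auto simp: coeff_contract coeff_gen_mult insert_absorb)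
  next
    case False
    show ?thesis
    proof (cases "p \<notin> S \<and> q \<in> S")
      case True
      define T where "T = S - {q}"
      have T: "finite T" "q \<notin> T" "p \<notin> T" "S = insert q T" "insert p (insert q T) - {q} = insert p T"
        using True S False by (auto simp: T_def)
      have "wedge_sign {q} {p} * wedge_sign {p} {q} = -1"
        using wedge_sign_pair[OF False] by simp
      then have "wedge_sign {p} {q} * wedge_sign {p} T * (wedge_sign {q} {p} * wedge_sign {q} T * c)
          = - (wedge_sign {q} T * (wedge_sign {p} T * c))" for c
        by algebra
      moreover have "coeff (contract p (gen q * x)) S = wedge_sign {p} {q} * wedge_sign {p} T *
          (wedge_sign {q} {p} * wedge_sign {q} T * coeff x (insert p T))"
        using T(1-3) False unfolding T(4)
        by (simp add: coeff_contract coeff_gen_mult[of "insert p (insert q T)"] T(5) wedge_sign_insert_right[of T]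
            del: insert_Diff_if)
      moreover have "coeff (gen q * contract p x) S
          = wedge_sign {q} T * (wedge_sign {p} T * coeff x (insert p T))"
        using T False by (simp add: coeff_contract coeff_gen_mult)
      ultimately show ?thesis
        using False by simp
    next
      case False': False
      with S False show ?thesis by (auto simp: coeff_contract coeff_gen_mult)
    qed
  qed
qed

lemma contract_contract:
  "contract p (contract q x) = - contract q (contract p x)"
proof (rule grassmann_eqI)
  fix S :: "(nat \<times> nat) set" assume S: "finite S"
  show "coeff (contract p (contract q x)) S = coeff (- contract q (contract p x)) S"
  proof (cases "p = q")
    case False
    have *: "coeff (contract a (contract b x)) S = wedge_sign {b} {a} * (wedge_sign {a} S * wedge_sign {b} S)
        * (if a \<in> S \<or> b \<in> S then 0 else coeff x (insert b (insert a S)))" if "a \<noteq> b" for a b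
      using S that by (auto simp add: coeff_contract wedge_sign_insert_right[of S])
    have "insert q (insert p S) = insert p (insert q S)"
      by auto
    with *[of p q] *[of q p] wedge_sign_pair[OF False] False show ?thesis
      by simp
  qed (simp add: coeff_contract)
qed

lemma gen_anticommute: "gen p * gen q = - (gen q * gen p)"
  using gen_mult_commute[of p "gen q"] by simp

lemma gen_square [simp]: "gen p * gen p = 0"
proof -
  have "2 *\<^sub>R (gen p * gen p) = 0"
    using gen_anticommute[of p p] by (simp add: scaleR_2 eq_neg_iff_add_eq_0)
  then show ?thesis by simp
qed

section \<open>Contractions of powers of a quadratic form\<close>

lemma eq_minus_self: "x = - x \<Longrightarrow> x = (0 :: grassmann)"
proof -
  assume "x = - x"
  then have "2 *\<^sub>R x = 0" by (simp add: scaleR_2 eq_neg_iff_add_eq_0)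
  then show ?thesis by simp
qed

lemma sum_reverse3:
  "(\<Sum>a\<in>A. \<Sum>b\<in>B. \<Sum>c\<in>C. f a b c) = (\<Sum>c\<in>C. \<Sum>b\<in>B. \<Sum>a\<in>A. f a b c :: 'a :: comm_monoid_add)"
proof -
  have "(\<Sum>a\<in>A. \<Sum>b\<in>B. \<Sum>c\<in>C. f a b c) = (\<Sum>a\<in>A. \<Sum>c\<in>C. \<Sum>b\<in>B. f a b c)"
    by (intro sum.cong sum.swap refl)
  also have "\<dots> = (\<Sum>c\<in>C. \<Sum>a\<in>A. \<Sum>b\<in>B. f a b c)"
    by (rule sum.swap)
  also have "\<dots> = (\<Sum>c\<in>C. \<Sum>b\<in>B. \<Sum>a\<in>A. f a b c)"
    by (intro sum.cong sum.swap refl)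
  finally show ?thesis .
qed

text \<open>\<open>even_over Z y\<close> and \<open>odd_over Z y\<close> record the rules by which
  an even, respectively odd, element free of the generators in \<open>Z\<close> passes other
  elements and contractions. Stated this way, closure under sums and products needs no bookkeeping
  of supports or degrees.\<close>

definition even_over :: "(nat \<times> nat) set \<Rightarrow> grassmann \<Rightarrow> bool" where
  "even_over Z y \<longleftrightarrow> (\<forall>x. y * x = x * y) \<and> (\<forall>p\<in>Z. \<forall>x. contract p (y * x) = y * contract p x)"

definition odd_over :: "(nat \<times> nat) set \<Rightarrow> grassmann \<Rightarrow> bool" where
  "odd_over Z y \<longleftrightarrow> (\<forall>x. y * x = grade_inv x * y) \<and> (\<forall>p\<in>Z. \<forall>x. contract p (y * x) = - (y * contract p x))"

lemma even_over_commute: "even_over Z y \<Longrightarrow> y * x = x * y"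
  and even_over_contract: "even_over Z y \<Longrightarrow> p \<in> Z \<Longrightarrow> contract p (y * x) = y * contract p x"
  by (auto simp: even_over_def)

lemma odd_over_commute: "odd_over Z y \<Longrightarrow> y * x = grade_inv x * y"
  and odd_over_contract: "odd_over Z y \<Longrightarrow> p \<in> Z \<Longrightarrow> contract p (y * x) = - (y * contract p x)"
  by (auto simp: odd_over_def)

lemma even_over_contract_self: "even_over Z y \<Longrightarrow> p \<in> Z \<Longrightarrow> contract p y = 0"
  using even_over_contract[of Z y p 1] by simp

lemma odd_over_contract_self: "odd_over Z y \<Longrightarrow> p \<in> Z \<Longrightarrow> contract p y = 0"
  using odd_over_contract[of Z y p 1] by simp

lemma even_over_zero [simp]: "even_over Z 0"
  and even_over_one [simp]: "even_over Z 1"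
  by (auto simp: even_over_def)

lemma even_over_add [intro]: "even_over Z x \<Longrightarrow> even_over Z y \<Longrightarrow> even_over Z (x + y)"
  and even_over_diff [intro]: "even_over Z x \<Longrightarrow> even_over Z y \<Longrightarrow> even_over Z (x - y)"
  and even_over_minus [intro]: "even_over Z x \<Longrightarrow> even_over Z (- x)"
  and even_over_scaleR [intro]: "even_over Z x \<Longrightarrow> even_over Z (r *\<^sub>R x)"
  by (auto simp: even_over_def algebra_simps)

lemma odd_over_zero [simp]: "odd_over Z 0"
  by (auto simp: odd_over_def)

lemma odd_over_add [intro]: "odd_over Z x \<Longrightarrow> odd_over Z y \<Longrightarrow> odd_over Z (x + y)"
  and odd_over_diff [intro]: "odd_over Z x \<Longrightarrow> odd_over Z y \<Longrightarrow> odd_over Z (x - y)"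
  and odd_over_minus [intro]: "odd_over Z x \<Longrightarrow> odd_over Z (- x)"
  and odd_over_scaleR [intro]: "odd_over Z x \<Longrightarrow> odd_over Z (r *\<^sub>R x)"
  by (auto simp: odd_over_def algebra_simps)

lemma even_over_sum [intro]: "(\<And>i. i \<in> I \<Longrightarrow> even_over Z (f i)) \<Longrightarrow> even_over Z (\<Sum>i\<in>I. f i)"
  by (induction I rule: infinite_finite_induct) auto

lemma odd_over_sum [intro]: "(\<And>i. i \<in> I \<Longrightarrow> odd_over Z (f i)) \<Longrightarrow> odd_over Z (\<Sum>i\<in>I. f i)"
  by (induction I rule: infinite_finite_induct) auto

lemma even_over_mult [intro]:
  assumes x: "even_over Z x" and y: "even_over Z y"
  shows "even_over Z (x * y)"
  unfolding even_over_def
proof (intro conjI allI ballI)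
  fix z p
  show "x * y * z = z * (x * y)"
    by (simp only: mult.assoc even_over_commute[OF y, of z])
      (simp only: even_over_commute[OF x, of "z"] grade_inv_grade_inv flip: mult.assoc)
  assume "p \<in> Z"
  then show "contract p (x * y * z) = x * y * contract p z"
    using x y by (simp add: mult.assoc even_over_contract)
qed

lemma odd_over_mult_odd [intro]:
  assumes x: "odd_over Z x" and y: "odd_over Z y"
  shows "even_over Z (x * y)"
  unfolding even_over_def
proof (intro conjI allI ballI)
  fix z p
  show "x * y * z = z * (x * y)"
    by (simp only: mult.assoc odd_over_commute[OF y, of z])
      (simp only: odd_over_commute[OF x, of "grade_inv z"] grade_inv_grade_inv flip: mult.assoc)
  assume "p \<in> Z"
  then show "contract p (x * y * z) = x * y * contract p z"
    using x y by (simp add: mult.assoc odd_over_contract)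
qed

lemma even_over_mult_odd [intro]:
  assumes x: "even_over Z x" and y: "odd_over Z y"
  shows "odd_over Z (x * y)"
  unfolding odd_over_def
proof (intro conjI allI ballI)
  fix z p
  show "x * y * z = grade_inv z * (x * y)"
    by (simp only: mult.assoc odd_over_commute[OF y, of z])
      (simp only: even_over_commute[OF x, of "grade_inv z"] grade_inv_grade_inv flip: mult.assoc)
  assume "p \<in> Z"
  then show "contract p (x * y * z) = - (x * y * contract p z)"
    using x y by (simp add: mult.assoc even_over_contract odd_over_contract)
qed

lemma odd_over_mult_even [intro]:
  assumes x: "odd_over Z x" and y: "even_over Z y"
  shows "odd_over Z (x * y)"
  unfolding odd_over_def
proof (intro conjI allI ballI)
  fix z p
  show "x * y * z = grade_inv z * (x * y)"
    by (simp only: mult.assoc even_over_commute[OF y, of z])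
      (simp only: odd_over_commute[OF x, of "z"] grade_inv_grade_inv flip: mult.assoc)
  assume "p \<in> Z"
  then show "contract p (x * y * z) = - (x * y * contract p z)"
    using x y by (simp add: mult.assoc even_over_contract odd_over_contract)
qed

lemma odd_over_gen: "p \<notin> Z \<Longrightarrow> odd_over Z (gen p)"
  by (auto simp: odd_over_def gen_mult_commute[symmetric] contract_gen_mult)

lemma even_over_subset: "even_over Z y \<Longrightarrow> Z' \<subseteq> Z \<Longrightarrow> even_over Z' y"
  by (auto simp: even_over_def)

lemma odd_over_subset: "odd_over Z y \<Longrightarrow> Z' \<subseteq> Z \<Longrightarrow> odd_over Z' y"
  by (auto simp: odd_over_def)

text \<open>
  Only the pairs (i, j) with i < j index the generators a_ij.  The unused pairs supply the auxiliary
  ones: theta_i sits at (i, i), and e1, e2 will be placed at (2, 0) and (3, 0).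
\<close>

abbreviation theta :: "nat \<Rightarrow> grassmann" where "theta i \<equiv> gen (i, i)"
abbreviation dtheta :: "nat \<Rightarrow> grassmann \<Rightarrow> grassmann" where "dtheta i \<equiv> contract (i, i)"
abbreviation diagonal :: "(nat \<times> nat) set" where "diagonal \<equiv> range (\<lambda>i. (i, i))"

section \<open>The form omega, the operator kappa and their commutators\<close>

definition quad :: "nat \<Rightarrow> (nat \<Rightarrow> nat \<Rightarrow> grassmann) \<Rightarrow> grassmann" where
  "quad n L = (1/2) *\<^sub>R (\<Sum>a<n. \<Sum>b<n. L a b * (theta a * theta b))"

definition dquad :: "nat \<Rightarrow> (nat \<Rightarrow> nat \<Rightarrow> grassmann) \<Rightarrow> grassmann \<Rightarrow> grassmann" where
  "dquad n K x = (1/2) *\<^sub>R (\<Sum>a<n. \<Sum>b<n. K a b * dtheta a (dtheta b x))"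

primrec faddeev :: "nat \<Rightarrow> (nat \<Rightarrow> nat \<Rightarrow> grassmann) \<Rightarrow> nat \<Rightarrow> nat \<Rightarrow> nat \<Rightarrow> grassmann" where
  "faddeev n M 0 = (\<lambda>i j. if i = j then 1 else 0)"
| "faddeev n M (Suc r) = (\<lambda>i j.
     (if i = j then (1 / (2 * real (Suc r))) *\<^sub>R (\<Sum>a<n. \<Sum>b<n. faddeev n M r a b * M b a) else 0)
     - (\<Sum>b<n. faddeev n M r i b * M b j))"

lemma even_over_faddeev:
  assumes "\<And>i j. even_over Z (M i j)"
  shows "even_over Z (faddeev n M r i j)"
  by (induction r arbitrary: i j)
    (auto intro!: assms even_over_diff even_over_minus even_over_scaleR even_over_sum even_over_mult)

lemma dquad_linear [simp]:
  "dquad n K 0 = 0" "dquad n K (x + y) = dquad n K x + dquad n K y"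
  "dquad n K (- x) = - dquad n K x" "dquad n K (x - y) = dquad n K x - dquad n K y"
  "dquad n K (r *\<^sub>R x) = r *\<^sub>R dquad n K x"
  unfolding dquad_def
  by (simp_all add: algebra_simps sum.distrib sum_subtractf sum_negf scaleR_right.sum)

lemma dquad_pow_linear [simp]:
  "(dquad n K ^^ r) 0 = 0" "(dquad n K ^^ r) (x + y) = (dquad n K ^^ r) x + (dquad n K ^^ r) y"
  "(dquad n K ^^ r) (- x) = - (dquad n K ^^ r) x"
  "(dquad n K ^^ r) (x - y) = (dquad n K ^^ r) x - (dquad n K ^^ r) y"
  "(dquad n K ^^ r) (c *\<^sub>R x) = c *\<^sub>R (dquad n K ^^ r) x"
  by (induction r) simp_all

lemma dquad_one [simp]: "dquad n K 1 = 0"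
  by (simp add: dquad_def)

lemma dquad_sum: "dquad n K (\<Sum>i\<in>I. f i) = (\<Sum>i\<in>I. dquad n K (f i))"
  by (induction I rule: infinite_finite_induct) simp_all

lemma dquad_pow_sum: "(dquad n K ^^ r) (\<Sum>i\<in>I. f i) = (\<Sum>i\<in>I. (dquad n K ^^ r) (f i))"
  by (induction I rule: infinite_finite_induct) simp_all

locale quadratic_pair =
  fixes n :: nat and K L :: "nat \<Rightarrow> nat \<Rightarrow> grassmann"
  assumes K_even: "even_over diagonal (K i j)" and K_skew: "K i j = - K j i"
    and L_even: "even_over diagonal (L i j)" and L_skew: "L i j = - L j i"
begin

abbreviation \<kappa> where "\<kappa> \<equiv> dquad n K"
abbreviation \<omega> where "\<omega> \<equiv> quad n L"

lemma K_diag [simp]: "K i i = 0" and L_diag [simp]: "L i i = 0"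
  using K_skew[of i i] L_skew[of i i] by (auto intro: eq_minus_self)

definition LK :: "nat \<Rightarrow> nat \<Rightarrow> grassmann" where "LK i j = (\<Sum>l<n. L i l * K l j)"

lemma LK_even: "even_over diagonal (LK i j)"
  unfolding LK_def using K_even L_even by (intro even_over_sum even_over_mult)

lemma dquad_even_mult:
  assumes "even_over diagonal c"
  shows "\<kappa> (c * x) = c * \<kappa> x"
proof -
  have "K a b * dtheta a (dtheta b (c * x)) = c * (K a b * dtheta a (dtheta b x))" for a b
    using assms by (simp add: even_over_contract) (metis even_over_commute mult.assoc)
  then show ?thesis by (simp add: dquad_def sum_distrib_left)
qed

text \<open>No sign appears, since \<open>c\<close> is passed by two contractions.\<close>

lemma dquad_odd_mult:
  assumes "odd_over diagonal c"
  shows "\<kappa> (c * x) = c * \<kappa> x"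
proof -
  have "K a b * dtheta a (dtheta b (c * x)) = c * (K a b * dtheta a (dtheta b x))" for a b
    using assms by (simp add: odd_over_contract) (metis K_even even_over_commute mult.assoc)
  then show ?thesis by (simp add: dquad_def sum_distrib_left)
qed

lemma dquad_pow_even_mult:
  "even_over diagonal c \<Longrightarrow> (\<kappa> ^^ r) (c * x) = c * (\<kappa> ^^ r) x"
  by (induction r) (simp_all add: dquad_even_mult)

lemma dquad_pow_odd_mult:
  "odd_over diagonal c \<Longrightarrow> (\<kappa> ^^ r) (c * x) = c * (\<kappa> ^^ r) x"
  by (induction r) (simp_all add: dquad_odd_mult)

lemma dquad_dtheta: "\<kappa> (dtheta c x) = dtheta c (\<kappa> x)"
proof -
  have "K a b * dtheta a (dtheta b (dtheta c x)) = dtheta c (K a b * dtheta a (dtheta b x))" for a b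
    using even_over_contract[OF K_even, of "(c, c)"]
      contract_contract[of "(b, b)" "(c, c)"] contract_contract[of "(a, a)" "(c, c)"]
    by simp
  then show ?thesis by (simp add: dquad_def contract_sum)
qed

lemma dquad_pow_dtheta: "(\<kappa> ^^ r) (dtheta c x) = dtheta c ((\<kappa> ^^ r) x)"
  by (induction r) (simp_all add: dquad_dtheta)

text \<open>The commutator of kappa with \<open>theta j\<close> is a first-order operator. The
  contributions from \<open>a = j\<close> and \<open>b = j\<close> agree by skew-symmetry of
  \<open>K\<close>, which absorbs the factor 1/2.\<close>

lemma dquad_theta_mult:
  assumes "j < n"
  shows "\<kappa> (theta j * x) = theta j * \<kappa> x + (\<Sum>a<n. K a j * dtheta a x)"
proof -
  have "K a b * dtheta a (dtheta b (theta j * x)) = (if b = j then K a j * dtheta a x else 0)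
      + (if a = j then K b j * dtheta b x else 0) + theta j * (K a b * dtheta a (dtheta b x))" for a b
  proof -
    have "K a b * (theta j * y) = theta j * (K a b * y)" for y
      by (metis K_even even_over_commute mult.assoc)
    then show ?thesis
      using K_skew[of j b] by (simp add: contract_gen_mult algebra_simps)
  qed
  then have "(\<Sum>a<n. \<Sum>b<n. K a b * dtheta a (dtheta b (theta j * x)))
      = 2 *\<^sub>R (\<Sum>a<n. K a j * dtheta a x) + theta j * (\<Sum>a<n. \<Sum>b<n. K a b * dtheta a (dtheta b x))"
    using assms by (simp add: sum.distrib sum_distrib_left scaleR_2 sum.delta)
      (subst sum.swap, simp add: assms)
  then show ?thesis by (simp add: dquad_def algebra_simps)
qed

text \<open>The commutator of kappa with \<open>theta j\<close> itself commutes with kappa, so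
  commuting with a power behaves like differentiating it.\<close>

lemma dquad_pow_theta_mult:
  assumes "j < n"
  shows "(\<kappa> ^^ Suc r) (theta j * x) = theta j * (\<kappa> ^^ Suc r) x
    + real (Suc r) *\<^sub>R (\<Sum>a<n. K a j * dtheta a ((\<kappa> ^^ r) x))"
proof (induction r)
  case 0
  then show ?case using dquad_theta_mult[OF assms] by simp
next
  case (Suc r)
  have "\<kappa> (\<Sum>a<n. K a j * dtheta a ((\<kappa> ^^ r) x)) = (\<Sum>a<n. K a j * dtheta a (\<kappa> ((\<kappa> ^^ r) x)))"
    by (simp add: dquad_sum dquad_even_mult[OF K_even] dquad_dtheta)
  moreover have "(\<kappa> ^^ Suc (Suc r)) (theta j * x) = \<kappa> ((\<kappa> ^^ Suc r) (theta j * x))"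
    by simp
  ultimately show ?case
    unfolding Suc by (simp add: dquad_theta_mult[OF assms] algebra_simps del: of_nat_Suc)
      (simp add: algebra_simps scaleR_2)
qed

lemma quad_even: "even_over {} \<omega>"
  unfolding quad_def using even_over_subset[OF L_even]
  by (intro even_over_scaleR even_over_sum even_over_mult odd_over_mult_odd odd_over_gen) auto

text \<open>Dual to \<open>dquad_theta_mult\<close>: contracting omega gives a linear form, and the
  two equal contributions again absorb the 1/2.\<close>

lemma dtheta_quad_mult:
  assumes "c < n"
  shows "dtheta c (\<omega> * x) = (\<Sum>b<n. L c b * theta b) * x + \<omega> * dtheta c x"
proof -
  have "dtheta c (L a b * (theta a * theta b) * x) = (if a = c then L c b * theta b * x else 0)
      + (if b = c then L c a * theta a * x else 0) + L a b * (theta a * theta b) * dtheta c x" for a b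
    using L_skew[of a c]
    by (simp add: contract_gen_mult even_over_contract[OF L_even] mult.assoc algebra_simps)
  then have "(\<Sum>a<n. \<Sum>b<n. dtheta c (L a b * (theta a * theta b) * x))
     = 2 *\<^sub>R (\<Sum>b<n. L c b * theta b * x) + (\<Sum>a<n. \<Sum>b<n. L a b * (theta a * theta b) * dtheta c x)"
    using assms by (simp add: sum.distrib scaleR_2) (subst sum.swap, simp add: assms)
  then show ?thesis
    by (simp add: quad_def contract_sum sum_distrib_right scaleR_add_right)
qed

lemma dtheta_quad_pow:
  assumes "c < n"
  shows "dtheta c (\<omega> ^ Suc r) = real (Suc r) *\<^sub>R (\<Sum>b<n. L c b * (theta b * \<omega> ^ r))"
proof (induction r)
  case 0
  then show ?case using dtheta_quad_mult[OF assms, of 1] by simp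
next
  case (Suc r)
  have "\<omega> * (\<Sum>b<n. L c b * (theta b * \<omega> ^ r)) = (\<Sum>b<n. L c b * (theta b * \<omega> ^ Suc r))"
    using even_over_commute[OF quad_even]
    by (simp add: sum_distrib_left sum_distrib_right) (metis (no_types, lifting) mult.assoc)
  moreover have "dtheta c (\<omega> ^ Suc (Suc r)) = (\<Sum>b<n. L c b * theta b) * \<omega> ^ Suc r + \<omega> * dtheta c (\<omega> ^ Suc r)"
    using dtheta_quad_mult[OF assms, of "\<omega> ^ Suc r"] by simp
  ultimately show ?case
    unfolding Suc by (simp add: sum_distrib_right mult.assoc algebra_simps scaleR_2 del: power_Suc)
qed

text \<open>Moving \<open>theta j\<close> out of kappa^(r+1) leaves \<open>theta j\<close> times the
  scalar kappa^(r+1) omega^(r+1), plus contractions of kappa^r omega^(r+1). The induction hypothesis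
  evaluates both; they become the trace term and the product term of \<open>faddeev\<close>.\<close>

theorem dquad_pow_theta_quad_pow:
  assumes "j < n"
  shows "(\<kappa> ^^ r) (theta j * \<omega> ^ r) = (fact r)\<^sup>2 *\<^sub>R (\<Sum>c<n. faddeev n LK r c j * theta c)"
  using assms
proof (induction r arbitrary: j)
  case 0
  then show ?case by (simp add: if_distrib if_distribR cong: if_cong)
next
  case (Suc r)
  let ?W = "faddeev n LK r" and ?F = "(fact r)\<^sup>2 :: real"
  have W_even: "even_over diagonal (?W i j)" for i j
    by (rule even_over_faddeev[OF LK_even])
  have dtheta_lin: "dtheta c (\<Sum>e<n. ?W e b * theta e) = ?W c b" if "c < n" for b c
  proof -
    have "dtheta c (?W e b * theta e) = (if e = c then ?W c b else 0)" for e
      using contract_gen_mult[of "(c, c)" "(e, e)" 1] by (simp add: even_over_contract[OF W_even])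
    with that show ?thesis by (simp add: contract_sum)
  qed
  have dquad_lin: "\<kappa> (\<Sum>e<n. ?W e b * theta e) = 0" for b
  proof -
    have "\<kappa> (?W e b * theta e) = 0" if "e < n" for e
      using dquad_theta_mult[OF that, of 1] dquad_one by (simp add: dquad_even_mult[OF W_even])
    then show ?thesis by (simp add: dquad_sum)
  qed
  \<comment> \<open>Splitting off one factor of omega^(r+1) leaves theta_a theta_b omega^r. When
    theta_a is moved out, kappa^(r+1) (theta_b omega^r) vanishes because kappa annihilates linear
    forms, and the commutator term contracts a linear form known by induction.\<close>
  have s: "(\<kappa> ^^ Suc r) (\<omega> ^ Suc r)
      = (fact (Suc r))\<^sup>2 *\<^sub>R (1 / (2 * real (Suc r))) *\<^sub>R (\<Sum>c<n. \<Sum>b<n. ?W c b * LK b c)"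
  proof -
    have "(\<kappa> ^^ Suc r) (theta a * (theta b * \<omega> ^ r))
        = (real (Suc r) * ?F) *\<^sub>R (\<Sum>c<n. K c a * ?W c b)" if "a < n" "b < n" for a b
    proof -
      let ?y = "theta b * \<omega> ^ r"
      have y: "(\<kappa> ^^ r) ?y = ?F *\<^sub>R (\<Sum>e<n. ?W e b * theta e)"
        using Suc.IH[OF \<open>b < n\<close>] .
      have y': "(\<kappa> ^^ Suc r) ?y = 0"
        by (simp add: y dquad_lin)
      have "(\<Sum>c<n. K c a * dtheta c ((\<kappa> ^^ r) ?y)) = (\<Sum>c<n. K c a * (?F *\<^sub>R ?W c b))"
        unfolding y by (intro sum.cong refl) (simp only: lessThan_iff contract_linear dtheta_lin)
      also have "\<dots> = ?F *\<^sub>R (\<Sum>c<n. K c a * ?W c b)"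
        by (simp only: mult_scaleR_right scaleR_right.sum)
      finally show ?thesis
        by (simp only: dquad_pow_theta_mult[OF \<open>a < n\<close>, of r ?y] y' mult_zero_right add_0_left scaleR_scaleR)
    qed
    then have summand: "(\<kappa> ^^ Suc r) (L a b * (theta a * theta b) * \<omega> ^ r)
        = (real (Suc r) * ?F) *\<^sub>R (L a b * (\<Sum>c<n. K c a * ?W c b))" if "a < n" "b < n" for a b
      using that by (simp only: mult.assoc dquad_pow_even_mult[OF L_even] mult_scaleR_right)
    have "(\<kappa> ^^ Suc r) (\<omega> ^ Suc r)
        = (1/2) *\<^sub>R (\<Sum>a<n. \<Sum>b<n. (\<kappa> ^^ Suc r) (L a b * (theta a * theta b) * \<omega> ^ r))"
      by (simp only: power_Suc quad_def[of n L] sum_distrib_right dquad_pow_sum dquad_pow_linear mult_scaleR_left)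
    also have "\<dots> = (1/2) *\<^sub>R (\<Sum>a<n. \<Sum>b<n. (real (Suc r) * ?F) *\<^sub>R (L a b * (\<Sum>c<n. K c a * ?W c b)))"
      using summand by (intro arg_cong[where f = "(*\<^sub>R) (1/2)"] sum.cong) auto
    also have "\<dots> = (real (Suc r) * ?F / 2) *\<^sub>R (\<Sum>a<n. \<Sum>b<n. L a b * (\<Sum>c<n. K c a * ?W c b))"
      by (simp only: scaleR_right.sum[symmetric] scaleR_scaleR) simp
    also have "(\<Sum>a<n. \<Sum>b<n. L a b * (\<Sum>c<n. K c a * ?W c b)) = (\<Sum>c<n. \<Sum>b<n. \<Sum>a<n. L a b * (K c a * ?W c b))"
      unfolding sum_distrib_left by (rule sum_reverse3)
    also have "\<dots> = (\<Sum>c<n. \<Sum>b<n. ?W c b * LK b c)"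
    proof (intro sum.cong refl)
      fix c b
      have "L a b * (K c a * ?W c b) = ?W c b * (L b a * K a c)" for a
        using L_skew[of a b] K_skew[of c a] even_over_commute[OF W_even[of c b], of "L b a * K a c"]
        by (simp only: minus_mult_minus mult_minus_left mult_minus_right mult.assoc minus_minus)
      then show "(\<Sum>a<n. L a b * (K c a * ?W c b)) = ?W c b * LK b c"
        by (simp add: LK_def sum_distrib_left)
    qed
    finally have "(\<kappa> ^^ Suc r) (\<omega> ^ Suc r)
        = (real (Suc r) * ?F / 2) *\<^sub>R (\<Sum>c<n. \<Sum>b<n. ?W c b * LK b c)" .
    moreover have "real (Suc r) * ?F / 2 = (fact (Suc r))\<^sup>2 * (1 / (2 * real (Suc r)))"
      by (simp add: power2_eq_square field_simps)
    ultimately show ?thesis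
      by (simp only: scaleR_scaleR)
  qed
  \<comment> \<open>The contraction commutes with kappa^r and differentiates omega^(r+1) into
    multiples of theta_b omega^r. The minus sign comes from reversing \<open>L a b\<close> to form
    the product \<open>LK\<close>.\<close>
  have t: "(\<Sum>a<n. K a j * dtheta a ((\<kappa> ^^ r) (\<omega> ^ Suc r)))
      = - ((real (Suc r) * ?F) *\<^sub>R (\<Sum>c<n. (\<Sum>b<n. ?W c b * LK b j) * theta c))"
  proof -
    have "dtheta a ((\<kappa> ^^ r) (\<omega> ^ Suc r))
        = (real (Suc r) * ?F) *\<^sub>R (\<Sum>b<n. L a b * (\<Sum>c<n. ?W c b * theta c))" if "a < n" for a
      unfolding dquad_pow_dtheta[symmetric] dtheta_quad_pow[OF that] dquad_pow_linear dquad_pow_sum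
        dquad_pow_even_mult[OF L_even] scaleR_right.sum
      using Suc.IH by (intro sum.cong) simp_all
    then have "(\<Sum>a<n. K a j * dtheta a ((\<kappa> ^^ r) (\<omega> ^ Suc r)))
        = (real (Suc r) * ?F) *\<^sub>R (\<Sum>a<n. \<Sum>b<n. \<Sum>c<n. K a j * (L a b * (?W c b * theta c)))"
      unfolding scaleR_right.sum sum_distrib_left
      by (intro sum.cong) (simp_all only: lessThan_iff mult_scaleR_right scaleR_right.sum sum_distrib_left)
    also have "(\<Sum>a<n. \<Sum>b<n. \<Sum>c<n. K a j * (L a b * (?W c b * theta c)))
        = (\<Sum>c<n. \<Sum>b<n. \<Sum>a<n. K a j * (L a b * (?W c b * theta c)))"
      by (rule sum_reverse3)
    also have "\<dots> = (\<Sum>c<n. \<Sum>b<n. - (?W c b * LK b j * theta c))"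
    proof (intro sum.cong refl)
      fix c b
      have "K a j * (L a b * (?W c b * theta c)) = - (?W c b * (L b a * K a j) * theta c)" for a
      proof -
        have "K a j * (L b a * (?W c b * theta c)) = L b a * (K a j * ?W c b) * theta c"
          using even_over_commute[OF L_even[of b a], of "K a j"] by (metis mult.assoc)
        also have "L b a * (K a j * ?W c b) = ?W c b * (L b a * K a j)"
          using even_over_commute[OF W_even[of c b], of "L b a * K a j"] by (simp only: mult.assoc)
        finally show ?thesis
          using L_skew[of a b] by (simp only: mult_minus_left mult_minus_right)
      qed
      then show "(\<Sum>a<n. K a j * (L a b * (?W c b * theta c))) = - (?W c b * LK b j * theta c)"
        by (simp add: LK_def sum_distrib_left sum_distrib_right sum_negf)
    qed
    finally show ?thesis
      by (simp add: sum_negf sum_distrib_right)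
  qed
  \<comment> \<open>The trace factor is even, so it moves to the left of \<open>theta j\<close> and
    the product takes the shape of a linear form.\<close>
  have "theta j * (x :: grassmann) = (\<Sum>c<n. (if c = j then x else 0) * theta c)" if "even_over diagonal x" for x
    using Suc.prems even_over_commute[OF that] by (simp add: if_distrib if_distribR cong: if_cong)
  moreover have "even_over diagonal ((1 / (2 * real (Suc r))) *\<^sub>R (\<Sum>c<n. \<Sum>b<n. ?W c b * LK b c))"
    using W_even LK_even by (intro even_over_scaleR even_over_sum even_over_mult)
  ultimately have u: "theta j * (1 / (2 * real (Suc r))) *\<^sub>R (\<Sum>c<n. \<Sum>b<n. ?W c b * LK b c) =
     (\<Sum>c<n. (if c = j then (1 / (2 * real (Suc r))) *\<^sub>R (\<Sum>c<n. \<Sum>b<n. ?W c b * LK b c) else 0) * theta c)"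
    by blast
  have "(\<kappa> ^^ Suc r) (theta j * \<omega> ^ Suc r)
      = (fact (Suc r))\<^sup>2 *\<^sub>R (theta j * (1 / (2 * real (Suc r))) *\<^sub>R (\<Sum>c<n. \<Sum>b<n. ?W c b * LK b c))
       - (fact (Suc r))\<^sup>2 *\<^sub>R (\<Sum>c<n. (\<Sum>b<n. ?W c b * LK b j) * theta c)"
    unfolding dquad_pow_theta_mult[OF Suc.prems] s t
    by (simp add: power2_eq_square mult_ac)
  also have "\<dots> = (fact (Suc r))\<^sup>2 *\<^sub>R (\<Sum>c<n. faddeev n LK (Suc r) c j * theta c)"
    unfolding u by (simp add: left_diff_distrib sum_subtractf scaleR_diff_right)
  finally show ?case .
qed

end

section \<open>Powers of the generic skew-symmetric matrix\<close>

abbreviation nonupper :: "(nat \<times> nat) set" where "nonupper \<equiv> {p. \<not> fst p < snd p}"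

definition agen :: "nat \<Rightarrow> nat \<Rightarrow> grassmann" where
  "agen i j = (if i < j then gen (i, j) else if j < i then - gen (j, i) else 0)"

lemma agen_skew: "agen i j = - agen j i"
  by (simp add: agen_def)

lemma agen_self [simp]: "agen i i = 0"
  by (simp add: agen_def)

lemma grade_inv_agen [simp]: "grade_inv (agen i j) = - agen i j"
  by (simp add: agen_def)

lemma odd_over_agen: "odd_over nonupper (agen i j)"
  by (auto simp: agen_def intro!: odd_over_gen odd_over_minus)

lemma diagonal_nonupper: "diagonal \<subseteq> nonupper"
  by auto

lemmas odd_over_agen_diagonal = odd_over_subset[OF odd_over_agen diagonal_nonupper]

primrec apow :: "nat \<Rightarrow> nat \<Rightarrow> nat \<Rightarrow> nat \<Rightarrow> grassmann" where
  "apow n 0 = (\<lambda>i j. if i = j then 1 else 0)"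
| "apow n (Suc k) = (\<lambda>i j. \<Sum>l<n. apow n k i l * agen l j)"

lemma parity_apow:
  "(even k \<longrightarrow> even_over nonupper (apow n k i j)) \<and> (odd k \<longrightarrow> odd_over nonupper (apow n k i j))"
proof (induction k arbitrary: i j)
  case (Suc k)
  show ?case
  proof (cases "even k")
    case True
    with Suc show ?thesis
      by (auto intro!: odd_over_sum even_over_mult_odd odd_over_agen)
  next
    case False
    with Suc show ?thesis
      by (auto intro!: even_over_sum odd_over_mult_odd odd_over_agen)
  qed
qed auto

lemma even_over_apow: "even k \<Longrightarrow> even_over nonupper (apow n k i j)"
  and odd_over_apow: "odd k \<Longrightarrow> odd_over nonupper (apow n k i j)"
  using parity_apow by auto

lemma contract_apow: "p \<in> nonupper \<Longrightarrow> contract p (apow n k i j) = 0"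
  by (cases "even k") (auto intro: even_over_contract_self odd_over_contract_self even_over_apow odd_over_apow)

lemma apow_add:
  assumes "j < n"
  shows "apow n (a + b) i j = (\<Sum>l<n. apow n a i l * apow n b l j)"
  using assms
proof (induction b arbitrary: j)
  case 0
  then show ?case by (simp add: if_distrib cong: if_cong)
next
  case (Suc b)
  have "apow n (a + Suc b) i j = (\<Sum>m<n. (\<Sum>l<n. apow n a i l * apow n b l m) * agen m j)"
    using Suc.IH by simp
  also have "\<dots> = (\<Sum>m<n. \<Sum>l<n. apow n a i l * (apow n b l m * agen m j))"
    by (simp add: sum_distrib_right mult.assoc)
  also have "\<dots> = (\<Sum>l<n. apow n a i l * apow n (Suc b) l j)"
    by (subst sum.swap) (simp add: sum_distrib_left)
  finally show ?case .
qed

lemma apow_1: "i < n \<Longrightarrow> apow n (Suc 0) i j = agen i j"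
  by (simp add: if_distribR if_distrib cong: if_cong)

section \<open>Traces of powers and the square of A\<close>

definition atrace :: "nat \<Rightarrow> nat \<Rightarrow> grassmann" where
  "atrace n k = (\<Sum>i<n. apow n k i i)"

lemma atrace_0: "atrace n 0 = of_nat n"
  by (simp add: atrace_def)

lemma odd_over_atrace: "odd k \<Longrightarrow> odd_over nonupper (atrace n k)"
  unfolding atrace_def by (intro odd_over_sum odd_over_apow)

text \<open>Cyclicity of the trace moves an odd entry of A past an odd entry of A^(k-1), so the
  trace equals its own negative. This vanishing is what lets the recursion be solved in closed
  form.\<close>

lemma atrace_even:
  assumes "even k" "k > 0"
  shows "atrace n k = 0"
proof -
  obtain h where h: "k = Suc h" "odd h"
    using assms by (cases k) auto
  have "apow n h i l * agen l i = - (agen l i * apow n h i l)" for i l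
    using odd_over_commute[OF odd_over_apow[OF h(2)], of n i l "agen l i"] by simp
  then have "atrace n k = (\<Sum>i<n. \<Sum>l<n. - (agen l i * apow n h i l))"
    by (simp add: atrace_def h(1))
  also have "\<dots> = - (\<Sum>l<n. \<Sum>i<n. agen l i * apow n h i l)"
    by (subst sum.swap) (simp add: sum_negf)
  also have "(\<Sum>l<n. \<Sum>i<n. agen l i * apow n h i l) = atrace n k"
    unfolding atrace_def
  proof (intro sum.cong refl)
    fix l assume "l \<in> {..<n}"
    then show "(\<Sum>i<n. agen l i * apow n h i l) = apow n k l l"
      using apow_add[of l n "Suc 0" h l] apow_1[of l n] h(1) by simp
  qed
  finally show ?thesis by (rule eq_minus_self)
qed

text \<open>Agrees with \<open>apow n 2\<close> only for row indices below \<open>n\<close>: there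
  the identity matrix in \<open>apow\<close> cuts off larger rows. \<open>asq\<close> is skew for
  all indices, as \<open>quadratic_pair\<close> demands.\<close>

definition asq :: "nat \<Rightarrow> nat \<Rightarrow> nat \<Rightarrow> grassmann" where
  "asq n i j = (\<Sum>l<n. agen i l * agen l j)"

lemma asq_eq_apow: "i < n \<Longrightarrow> asq n i j = apow n 2 i j"
  by (simp only: asq_def numeral_2_eq_2 apow.simps(2)[of n "Suc 0"] apow_1)

lemma asq_skew: "asq n i j = - asq n j i"
proof -
  have "agen i l * agen l j = - (agen j l * agen l i)" for l
    using odd_over_commute[OF odd_over_agen, of i l "agen l j"] agen_skew[of l j] agen_skew[of i l] by simp
  then show ?thesis by (simp add: asq_def sum_negf)
qed

lemma even_over_asq: "even_over nonupper (asq n i j)"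
  unfolding asq_def by (intro even_over_sum odd_over_mult_odd odd_over_agen)

section \<open>The perturbed pair K, L and the product LK\<close>

locale odd_pair =
  fixes n :: nat and e1 e2 :: grassmann
  assumes e1_odd: "odd_over diagonal e1" and e2_odd: "odd_over diagonal e2"
    and e1_e1: "e1 * e1 = 0" and e2_e2: "e2 * e2 = 0" and e1_e2: "e1 * e2 = - (e2 * e1)"
    and grade_inv_e2: "grade_inv e2 = - e2"
begin

definition K where "K i j = asq n i j + e1 * agen i j"
definition L where "L i j = asq n i j + e2 * agen i j"

sublocale quadratic_pair n K L
proof
  fix i j
  note even_over_subset[OF even_over_asq diagonal_nonupper]
  then show "even_over diagonal (K i j)" "even_over diagonal (L i j)"
    unfolding K_def L_def
    by (intro even_over_add odd_over_mult_odd odd_over_agen_diagonal e1_odd e2_odd; assumption)+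
  show "K i j = - K j i" "L i j = - L j i"
    using asq_skew[of n i j] agen_skew[of i j] by (simp_all add: K_def L_def)
qed

definition E where "E = e1 + e2"

lemma E_odd: "odd_over diagonal E"
  unfolding E_def using e1_odd e2_odd by auto

lemma e2_e1_even: "even_over diagonal (e2 * e1)"
  using e1_odd e2_odd by auto

text \<open>\<open>E\<close> passes \<open>x\<close> at the cost of \<open>grade_inv\<close>, and
  its square is 0. With the next three lemmas, a product containing two factors from
  \<open>E\<close> and \<open>e2 * e1\<close> vanishes, so all expansions stop at first
  order.\<close>

lemma E_mult_E: "E * x * E = 0"
proof -
  have "E * x * E = E * E * grade_inv x"
    using odd_over_commute[OF E_odd, of "grade_inv x"] by (simp add: mult.assoc)
  moreover have "E * E = 0"
    by (simp add: E_def algebra_simps e1_e1 e2_e2 e1_e2)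
  ultimately show ?thesis by simp
qed

lemma E_mult_e2_e1: "E * x * (e2 * e1) = 0"
proof -
  have "e1 * (e2 * e1) = 0"
    using e1_e2 e1_e1 by (metis mult.assoc mult_minus_left mult_zero_right neg_equal_0_iff_equal)
  moreover have "e2 * (e2 * e1) = 0"
    using e2_e2 by (metis mult.assoc mult_zero_left)
  ultimately have "E * (e2 * e1) = 0"
    by (simp add: E_def distrib_right)
  then show ?thesis
    using even_over_commute[OF e2_e1_even, of x] by (metis mult.assoc mult_zero_left)
qed

lemma e2_e1_mult_E: "e2 * e1 * x * E = 0"
proof -
  have "e2 * e1 * x * E = x * (e2 * e1 * E)"
    using even_over_commute[OF e2_e1_even, of x] by (simp add: mult.assoc)
  moreover have "e2 * e1 * E = E * 1 * (e2 * e1)"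
    using even_over_commute[OF e2_e1_even, of E] by simp
  ultimately show ?thesis by (simp only: E_mult_e2_e1) simp
qed

lemma e2_e1_mult_e2_e1: "e2 * e1 * x * (e2 * e1) = 0"
proof -
  have "e2 * e1 * (e2 * e1) = 0"
    using e1_e2 e2_e2 by (metis (no_types, lifting) mult.assoc mult_minus_left mult_minus_right mult_zero_left neg_equal_0_iff_equal)
  then show ?thesis
    using even_over_commute[OF e2_e1_even, of x] by (metis mult.assoc mult_zero_left)
qed

text \<open>This expands (A^2 + e2 A)(A^2 + e1 A); the minus sign arises when \<open>e1\<close>
  passes an odd entry of A.\<close>

lemma LK_eq:
  assumes "i < n" "j < n"
  shows "LK i j = apow n 4 i j + E * apow n 3 i j - e2 * e1 * apow n 2 i j"
proof -
  have "L i l * K l j = asq n i l * asq n l j + e1 * (asq n i l * agen l j)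
      + e2 * (agen i l * asq n l j) - e2 * e1 * (agen i l * agen l j)" for l
  proof -
    have "asq n i l * (e1 * agen l j) = e1 * (asq n i l * agen l j)"
      using even_over_commute[OF even_over_asq, of n i l e1] by (metis mult.assoc)
    moreover have "e2 * agen i l * (e1 * agen l j) = - (e2 * e1 * (agen i l * agen l j))"
    proof -
      have "agen i l * e1 = - (e1 * agen i l)"
        using odd_over_commute[OF e1_odd, of "agen i l"] by simp
      moreover have "e2 * agen i l * (e1 * agen l j) = e2 * (agen i l * e1) * agen l j"
        by (simp only: mult.assoc)
      ultimately show ?thesis
        by (simp add: mult.assoc)
    qed
    ultimately show ?thesis
      by (simp add: K_def L_def algebra_simps)
  qed
  then have "LK i j = (\<Sum>l<n. asq n i l * asq n l j) + e1 * (\<Sum>l<n. asq n i l * agen l j)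
      + e2 * (\<Sum>l<n. agen i l * asq n l j) - e2 * e1 * asq n i j"
    by (simp add: LK_def sum.distrib sum_subtractf sum_distrib_left asq_def)
  moreover have "(\<Sum>l<n. asq n i l * asq n l j) = apow n 4 i j"
    using apow_add[OF assms(2), of 2 2 i] assms by (simp add: asq_eq_apow)
  moreover have "(\<Sum>l<n. asq n i l * agen l j) = apow n 3 i j"
    using assms by (simp add: asq_eq_apow numeral_3_eq_3 numeral_2_eq_2 del: apow.simps(1))
  moreover have "(\<Sum>l<n. agen i l * asq n l j) = apow n 3 i j"
    using apow_add[OF assms(2), of "Suc 0" 2 i] assms by (simp add: asq_eq_apow apow_1 numeral_3_eq_3 del: apow.simps)
  ultimately show ?thesis
    using assms by (simp add: asq_eq_apow E_def algebra_simps)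
qed

end

section \<open>Closed solution of the recursion\<close>

definition dmat :: "nat \<Rightarrow> nat \<Rightarrow> nat \<Rightarrow> nat \<Rightarrow> grassmann" where
  "dmat n r i j = real r *\<^sub>R apow n (4 * r - 1) i j
    - (1/2) *\<^sub>R (\<Sum>k<r. atrace n (4 * k + 3) * apow n (4 * (r - 1 - k)) i j)"

lemma odd_over_dmat: "odd_over nonupper (dmat n r i j)"
proof -
  have "odd_over nonupper (real r *\<^sub>R apow n (4 * r - 1) i j)"
    by (cases r) (auto intro!: odd_over_scaleR odd_over_apow)
  moreover have "odd_over nonupper (\<Sum>k<r. atrace n (4 * k + 3) * apow n (4 * (r - 1 - k)) i j)"
    by (intro odd_over_sum odd_over_mult_even odd_over_atrace even_over_apow) auto
  ultimately show ?thesis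
    unfolding dmat_def by (rule odd_over_diff[OF _ odd_over_scaleR])
qed

text \<open>Multiplication by A^4 shifts all exponents. What is missing from
  \<open>dmat n (Suc r)\<close> is one more copy of A^(4r+3) and the summand k = r, a multiple of
  the identity.\<close>

lemma dmat_mult_apow_4:
  assumes "j < n"
  shows "(\<Sum>b<n. dmat n r i b * apow n 4 b j)
    = dmat n (Suc r) i j - apow n (4 * r + 3) i j + (if i = j then (1/2) *\<^sub>R atrace n (4 * r + 3) else 0)"
proof -
  have add: "(\<Sum>b<n. apow n a i b * apow n 4 b j) = apow n (a + 4) i j" for a
    using apow_add[OF assms] by simp
  have "(\<Sum>b<n. dmat n r i b * apow n 4 b j)
      = real r *\<^sub>R (\<Sum>b<n. apow n (4 * r - 1) i b * apow n 4 b j)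
       - (1/2) *\<^sub>R (\<Sum>b<n. \<Sum>k<r. atrace n (4 * k + 3) * (apow n (4 * (r - 1 - k)) i b * apow n 4 b j))"
    by (simp add: dmat_def left_diff_distrib sum_subtractf scaleR_right.sum sum_distrib_right mult.assoc)
  also have "(\<Sum>b<n. \<Sum>k<r. atrace n (4 * k + 3) * (apow n (4 * (r - 1 - k)) i b * apow n 4 b j))
      = (\<Sum>k<r. atrace n (4 * k + 3) * apow n (4 * (r - 1 - k) + 4) i j)"
    by (subst sum.swap) (simp only: add flip: sum_distrib_left)
  also have "\<dots> = (\<Sum>k<r. atrace n (4 * k + 3) * apow n (4 * (Suc r - 1 - k)) i j)"
  proof (intro sum.cong refl)
    fix k assume "k \<in> {..<r}"
    then have "4 * (r - 1 - k) + 4 = 4 * (Suc r - 1 - k)" by auto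
    then show "atrace n (4 * k + 3) * apow n (4 * (r - 1 - k) + 4) i j
        = atrace n (4 * k + 3) * apow n (4 * (Suc r - 1 - k)) i j" by (simp only:)
  qed
  also have "real r *\<^sub>R (\<Sum>b<n. apow n (4 * r - 1) i b * apow n 4 b j) = real r *\<^sub>R apow n (4 * r + 3) i j"
  \<comment> \<open>For r = 0 the truncated exponent \<open>4 * r - 1\<close> does not shift
    correctly, but the factor \<open>real r\<close> is 0.\<close>
  proof (cases r)
    case (Suc s)
    then have "4 * r - 1 + 4 = 4 * r + 3" by simp
    then show ?thesis by (simp only: add)
  qed simp
  also have "4 * r + 3 = 4 * Suc r - 1" by simp
  finally show ?thesis
    by (simp add: dmat_def algebra_simps del: apow.simps(2) cong: if_cong)
qed

context odd_pair
begin

text \<open>The solution of the recursion for \<open>LK\<close> up to the sign (-1)^r: A^(4r) with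
  its corrections along \<open>E\<close> and \<open>e2 * e1\<close>.\<close>

definition C where
  "C r i j = apow n (4 * r) i j + E * dmat n r i j - real r *\<^sub>R (e2 * e1 * apow n (4 * r - 2) i j)"

text \<open>The cross term E A^(4r+3) supplies the copy of A^(4r+3) missing in
  \<open>dmat_mult_apow_4\<close>, so only the half trace on the diagonal separates the product from
  \<open>C (Suc r)\<close>.\<close>

lemma C_mult_LK:
  assumes "i < n" "j < n"
  shows "(\<Sum>b<n. C r i b * LK b j) = C (Suc r) i j + (if i = j then (1/2) *\<^sub>R (E * atrace n (4 * r + 3)) else 0)"
proof -
  have add: "(\<Sum>b<n. apow n a i b * apow n c b j) = apow n (a + c) i j" for a c
    using apow_add[OF assms(2)] by simp
  have "C r i b * LK b j = apow n (4 * r) i b * apow n 4 b j + E * (apow n (4 * r) i b * apow n 3 b j)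
      - e2 * e1 * (apow n (4 * r) i b * apow n 2 b j) + E * (dmat n r i b * apow n 4 b j)
      - real r *\<^sub>R (e2 * e1 * (apow n (4 * r - 2) i b * apow n 4 b j))" if "b < n" for b
  proof -
    have 1: "apow n (4 * r) i b * LK b j = apow n (4 * r) i b * apow n 4 b j
      + E * (apow n (4 * r) i b * apow n 3 b j) - e2 * e1 * (apow n (4 * r) i b * apow n 2 b j)"
    proof -
      have ev: "even_over nonupper (apow n (4 * r) i b)"
        by (rule even_over_apow) simp
      have "apow n (4 * r) i b * (x * y) = x * (apow n (4 * r) i b * y)" for x y
        using even_over_commute[OF ev, of x] by (metis mult.assoc)
      then show ?thesis
        by (simp add: LK_eq[OF that assms(2)] distrib_left right_diff_distrib)
    qed
    \<comment> \<open>A factor that annihilates \<open>E\<close> and \<open>e2 * e1\<close> sees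
      only the leading term A^4 of \<open>LK\<close>.\<close>
    have 2: "x * LK b j = x * apow n 4 b j" if "x * E = 0" "x * (e2 * e1) = 0" for x
      using that by (simp add: LK_eq[OF \<open>b < n\<close> assms(2)] distrib_left right_diff_distrib flip: mult.assoc)
    have 3: "E * dmat n r i b * LK b j = E * dmat n r i b * apow n 4 b j"
      by (rule 2) (rule E_mult_E E_mult_e2_e1)+
    have 4: "e2 * e1 * apow n (4 * r - 2) i b * LK b j = e2 * e1 * apow n (4 * r - 2) i b * apow n 4 b j"
      by (rule 2) (rule e2_e1_mult_E e2_e1_mult_e2_e1)+
    show ?thesis
      unfolding C_def distrib_right left_diff_distrib mult_scaleR_left 1 3 4
      by (simp add: mult.assoc)
  qed
  then have "(\<Sum>b<n. C r i b * LK b j) = (\<Sum>b<n. apow n (4 * r) i b * apow n 4 b j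
      + E * (apow n (4 * r) i b * apow n 3 b j)
      - e2 * e1 * (apow n (4 * r) i b * apow n 2 b j) + E * (dmat n r i b * apow n 4 b j)
      - real r *\<^sub>R (e2 * e1 * (apow n (4 * r - 2) i b * apow n 4 b j)))"
    by (intro sum.cong refl) (simp only: lessThan_iff)
  also have "\<dots> = apow n (4 * r + 4) i j + E * apow n (4 * r + 3) i j
      - e2 * e1 * apow n (4 * r + 2) i j + E * (\<Sum>b<n. dmat n r i b * apow n 4 b j)
      - real r *\<^sub>R (e2 * e1 * apow n (4 * r - 2 + 4) i j)"
    by (simp only: sum.distrib sum_subtractf add flip: sum_distrib_left scaleR_right.sum)
  also have "real r *\<^sub>R (e2 * e1 * apow n (4 * r - 2 + 4) i j) = real r *\<^sub>R (e2 * e1 * apow n (4 * r + 2) i j)"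
  proof (cases r)
    case (Suc s)
    then have "4 * r - 2 + 4 = 4 * r + 2" by simp
    then show ?thesis by (simp only:)
  qed simp
  also have "4 * r + 4 = 4 * Suc r" by simp
  also have "4 * r + 2 = 4 * Suc r - 2" by simp
  finally show ?thesis
    unfolding dmat_mult_apow_4[OF assms(2)] C_def
    by (simp add: algebra_simps del: apow.simps(2))
qed

text \<open>Traces of positive even powers vanish. The half traces from the \<open>n\<close>
  diagonal entries in \<open>C_mult_LK\<close> cancel the multiple n/2 of tr(A^(4r+3)) inside the
  trace of \<open>dmat\<close>.\<close>

lemma trace_C_LK:
  "(\<Sum>a<n. \<Sum>b<n. C r a b * LK b a) = real (Suc r) *\<^sub>R (E * atrace n (4 * r + 3))"
proof -
  have "(\<Sum>a<n. \<Sum>b<n. C r a b * LK b a)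
      = (\<Sum>a<n. C (Suc r) a a + (1/2) *\<^sub>R (E * atrace n (4 * r + 3)))"
    by (intro sum.cong refl) (simp add: C_mult_LK)
  also have "\<dots> = atrace n (4 * Suc r) + E * (\<Sum>a<n. dmat n (Suc r) a a)
      - real (Suc r) *\<^sub>R (e2 * e1 * atrace n (4 * Suc r - 2)) + of_nat n * (1/2) *\<^sub>R (E * atrace n (4 * r + 3))"
    by (simp only: C_def atrace_def sum.distrib sum_subtractf sum_constant card_lessThan
        sum_distrib_left scaleR_right.sum)
  also have "atrace n (4 * Suc r) = 0"
    by (rule atrace_even) simp_all
  also have "atrace n (4 * Suc r - 2) = 0"
    by (rule atrace_even) simp_all
  also have "(\<Sum>a<n. dmat n (Suc r) a a) = real (Suc r) *\<^sub>R atrace n (4 * r + 3) - (1/2) *\<^sub>R (of_nat n * atrace n (4 * r + 3))"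
  proof -
    have "(\<Sum>a<n. dmat n (Suc r) a a) = real (Suc r) *\<^sub>R atrace n (4 * Suc r - 1)
      - (1/2) *\<^sub>R (\<Sum>k<Suc r. atrace n (4 * k + 3) * atrace n (4 * (Suc r - 1 - k)))"
      unfolding dmat_def sum_subtractf scaleR_right.sum[symmetric] atrace_def sum_distrib_left
      by (subst (2) sum.swap) (rule refl)
    \<comment> \<open>Only k = r survives, where the second factor is tr(A^0) = n; the other second
      factors are traces of positive even powers.\<close>
    also have "(\<Sum>k<Suc r. atrace n (4 * k + 3) * atrace n (4 * (Suc r - 1 - k)))
       = (\<Sum>k<Suc r. if k = r then atrace n (4 * r + 3) * of_nat n else 0)"
      by (intro sum.cong refl) (auto simp: atrace_0 atrace_even)
    also have "4 * Suc r - 1 = 4 * r + 3" by simp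
    finally show ?thesis by (simp add: mult_of_nat_commute)
  qed
  finally show ?thesis
    by (simp add: algebra_simps mult_of_nat_commute)
qed

text \<open>Dividing \<open>trace_C_LK\<close> by 2(r+1) gives exactly the half trace in
  \<open>C_mult_LK\<close>. The two cancel, and the recursion reduces to a change of sign.\<close>

theorem faddeev_LK:
  assumes "i < n" "j < n"
  shows "faddeev n LK r i j = (-1) ^ r *\<^sub>R C r i j"
  using assms
proof (induction r arbitrary: i j)
  case 0
  then show ?case by (simp add: C_def dmat_def)
next
  case (Suc r)
  have "(\<Sum>a<n. \<Sum>b<n. faddeev n LK r a b * LK b a) = (-1) ^ r *\<^sub>R (\<Sum>a<n. \<Sum>b<n. C r a b * LK b a)"
    unfolding scaleR_right.sum by (intro sum.cong refl) (simp add: Suc.IH)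
  moreover have "(\<Sum>b<n. faddeev n LK r i b * LK b j) = (-1) ^ r *\<^sub>R (\<Sum>b<n. C r i b * LK b j)"
    unfolding scaleR_right.sum using Suc.prems by (intro sum.cong refl) (simp add: Suc.IH)
  ultimately show ?case
    unfolding faddeev.simps trace_C_LK C_mult_LK[OF Suc.prems]
    by (simp add: algebra_simps del: of_nat_Suc)
qed

end

section \<open>Top-degree elements\<close>

text \<open>A lower bound on the theta-degree of every monomial replaces homogeneity; it survives
  multiplication on the left by arbitrary elements.\<close>

definition theta_degree_ge :: "nat \<Rightarrow> nat \<Rightarrow> grassmann \<Rightarrow> bool" where
  "theta_degree_ge n d x \<longleftrightarrow> (\<forall>S. finite S \<longrightarrow> coeff x S \<noteq> 0 \<longrightarrow> d \<le> card {i. i < n \<and> (i, i) \<in> S})"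

lemma theta_degree_ge_0 [simp]: "theta_degree_ge n 0 x"
  by (simp add: theta_degree_ge_def)

lemma theta_degree_ge_zero [simp]: "theta_degree_ge n d 0"
  by (simp add: theta_degree_ge_def)

lemma theta_degree_ge_add:
  "theta_degree_ge n d x \<Longrightarrow> theta_degree_ge n d y \<Longrightarrow> theta_degree_ge n d (x + y)"
  unfolding theta_degree_ge_def by (metis add.right_neutral coeff_simps(2))

lemma theta_degree_ge_sum:
  "(\<And>i. i \<in> I \<Longrightarrow> theta_degree_ge n d (f i)) \<Longrightarrow> theta_degree_ge n d (\<Sum>i\<in>I. f i)"
  by (induction I rule: infinite_finite_induct) (simp_all add: theta_degree_ge_add)

lemma theta_degree_ge_mult:
  assumes "theta_degree_ge n d x"
  shows "theta_degree_ge n d (y * x)"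
  unfolding theta_degree_ge_def
proof (intro allI impI)
  fix S :: "(nat \<times> nat) set" assume S: "finite S" "coeff (y * x) S \<noteq> 0"
  have "coeff (y * x) S = (\<Sum>T\<in>Pow S. wedge_sign T (S - T) * coeff y T * coeff x (S - T))"
    using S(1) by (simp add: times_grassmann.rep_eq ext_mult_def)
  with S(2) obtain T where "coeff x (S - T) \<noteq> 0"
    by (metis (no_types, lifting) mult_zero_right sum.neutral)
  then have "d \<le> card {i. i < n \<and> (i, i) \<in> S - T}"
    using assms S(1) unfolding theta_degree_ge_def by blast
  also have "\<dots> \<le> card {i. i < n \<and> (i, i) \<in> S}"
    by (intro card_mono) auto
  finally show "d \<le> card {i. i < n \<and> (i, i) \<in> S}" .
qed

lemma theta_degree_ge_theta_mult:
  assumes "theta_degree_ge n d x" "k < n"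
  shows "theta_degree_ge n (Suc d) (theta k * x)"
  unfolding theta_degree_ge_def
proof (intro allI impI)
  fix S :: "(nat \<times> nat) set" assume S: "finite S" "coeff (theta k * x) S \<noteq> 0"
  then have k: "(k, k) \<in> S" and "coeff x (S - {(k, k)}) \<noteq> 0"
    by (auto simp: coeff_gen_mult split: if_splits)
  then have "d \<le> card {i. i < n \<and> (i, i) \<in> S - {(k, k)}}"
    using assms(1) S(1) unfolding theta_degree_ge_def by blast
  moreover have "{i. i < n \<and> (i, i) \<in> S} = insert k {i. i < n \<and> (i, i) \<in> S - {(k, k)}}"
    using k assms(2) by auto
  ultimately show "Suc d \<le> card {i. i < n \<and> (i, i) \<in> S}"
    by simp
qed

lemma theta_degree_ge_eq_zero:
  assumes "theta_degree_ge n d x" "n < d"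
  shows "x = 0"
proof (rule grassmann_eqI)
  fix S :: "(nat \<times> nat) set" assume "finite S"
  have "card {i. i < n \<and> (i, i) \<in> S} \<le> card {..<n}"
    by (intro card_mono) auto
  then show "coeff x S = coeff 0 S"
    using assms \<open>finite S\<close> unfolding theta_degree_ge_def by fastforce
qed

lemma scaleR_pow: "(c *\<^sub>R x) ^ k = c ^ k *\<^sub>R x ^ k" for x :: grassmann
  by (induction k) simp_all

section \<open>The odd derivation nabla\<close>

definition eta :: "nat \<Rightarrow> nat \<Rightarrow> grassmann" where
  "eta n j = (\<Sum>l<n. agen j l * theta l)"

text \<open>This is omega_0 of the overview; \<open>eta_theta\<close> is alpha.\<close>

definition eta_square :: "nat \<Rightarrow> grassmann" where
  "eta_square n = (\<Sum>j<n. eta n j * eta n j)"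

definition eta_theta :: "nat \<Rightarrow> grassmann" where
  "eta_theta n = (\<Sum>j<n. eta n j * theta j)"

definition nabla :: "nat \<Rightarrow> grassmann \<Rightarrow> grassmann" where
  "nabla n x = (\<Sum>j<n. eta n j * dtheta j x)"

lemma even_over_eta: "even_over {} (eta n j)"
  unfolding eta_def
  by (intro even_over_sum odd_over_mult_odd odd_over_gen odd_over_subset[OF odd_over_agen]) auto

lemma even_over_eta_square: "even_over {} (eta_square n)"
  unfolding eta_square_def by (intro even_over_sum even_over_mult even_over_eta)

lemma odd_over_eta_theta: "odd_over {} (eta_theta n)"
  unfolding eta_theta_def by (intro odd_over_sum even_over_mult_odd even_over_eta odd_over_gen) auto

lemma eta_commute: "x * (eta n j * y) = eta n j * (x * y)"
  using even_over_commute[OF even_over_eta, of n j x] by (metis mult.assoc)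

lemma theta_degree_ge_eta_mult:
  "theta_degree_ge n d x \<Longrightarrow> theta_degree_ge n (Suc d) (eta n j * x)"
  unfolding eta_def sum_distrib_right mult.assoc
  by (intro theta_degree_ge_sum theta_degree_ge_mult theta_degree_ge_theta_mult) auto

lemma theta_degree_ge_eta_square_pow: "theta_degree_ge n (2 * r) (eta_square n ^ r)"
proof (induction r)
  case (Suc r)
  then have "theta_degree_ge n (Suc (Suc (2 * r))) (eta_square n * eta_square n ^ r)"
    unfolding eta_square_def[of n] sum_distrib_right mult.assoc
    by (intro theta_degree_ge_sum theta_degree_ge_eta_mult) (simp flip: eta_square_def)
  then show ?case by simp
qed simp

lemma theta_degree_ge_eta_theta_mult:
  "theta_degree_ge n d x \<Longrightarrow> theta_degree_ge n (Suc (Suc d)) (eta_theta n * x)"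
  unfolding eta_theta_def sum_distrib_right mult.assoc
  by (intro theta_degree_ge_sum theta_degree_ge_eta_mult theta_degree_ge_theta_mult) auto

lemma dtheta_eta_mult:
  assumes "k < n"
  shows "dtheta k (eta n j * x) = eta n j * dtheta k x - agen j k * x"
proof -
  have "dtheta k (agen j l * (theta l * x)) = agen j l * (theta l * dtheta k x) - (if l = k then agen j k * x else 0)" for l
    using odd_over_contract[OF odd_over_agen_diagonal, of "(k, k)"]
    by (simp add: contract_gen_mult algebra_simps)
  with assms show ?thesis
    by (simp add: eta_def sum_distrib_right contract_sum mult.assoc sum_subtractf)
qed

lemma nabla_one: "nabla n 1 = 0"
  by (simp add: nabla_def)

lemma nabla_sum: "nabla n (\<Sum>i\<in>I. f i) = (\<Sum>i\<in>I. nabla n (f i))"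
  unfolding nabla_def contract_sum sum_distrib_left by (rule sum.swap)

lemma nabla_theta_mult:
  assumes "k < n"
  shows "nabla n (theta k * x) = eta n k * x - theta k * nabla n x"
proof -
  have "eta n j * dtheta j (theta k * x) = (if j = k then eta n k * x else 0) - theta k * (eta n j * dtheta j x)" for j
    by (simp add: contract_gen_mult right_diff_distrib eta_commute)
  with assms show ?thesis
    by (simp add: nabla_def sum_subtractf sum_distrib_left)
qed

text \<open>\<open>eta n k\<close> is even and is passed without sign. In its own image the minus
  sign comes from the contraction passing the odd entry \<open>agen k j\<close>.\<close>

lemma nabla_eta_mult:
  "nabla n (eta n k * x) = eta n k * nabla n x - (\<Sum>j<n. eta n j * (agen k j * x))"
proof -
  have "eta n j * dtheta j (eta n k * x) = eta n k * (eta n j * dtheta j x) - eta n j * (agen k j * x)" if "j < n" for j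
    using that by (simp add: dtheta_eta_mult right_diff_distrib eta_commute[of "eta n j" n k])
  then have "nabla n (eta n k * x) = (\<Sum>j<n. eta n k * (eta n j * dtheta j x) - eta n j * (agen k j * x))"
    unfolding nabla_def by (intro sum.cong) auto
  then show ?thesis
    by (simp add: nabla_def sum_subtractf sum_distrib_left)
qed

text \<open>The image of omega_0 is a multiple of the sum of eta_j a_kj eta_k, which is zero because
  the eta are central and A is skew.\<close>

lemma nabla_eta_square_mult: "nabla n (eta_square n * x) = eta_square n * nabla n x"
proof -
  have "nabla n (eta_square n * x) = (\<Sum>k<n. nabla n (eta n k * (eta n k * x)))"
    by (simp add: eta_square_def sum_distrib_right mult.assoc nabla_sum)
  also have "\<dots> = (\<Sum>k<n. eta n k * (eta n k * nabla n x)
      - 2 *\<^sub>R (\<Sum>j<n. eta n j * (agen k j * (eta n k * x))))"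
  proof (intro sum.cong refl)
    fix k
    have "eta n k * (\<Sum>j<n. eta n j * (agen k j * x)) = (\<Sum>j<n. eta n j * (agen k j * (eta n k * x)))"
      by (simp add: sum_distrib_left eta_commute[of _ n k])
    then show "nabla n (eta n k * (eta n k * x)) = eta n k * (eta n k * nabla n x)
      - 2 *\<^sub>R (\<Sum>j<n. eta n j * (agen k j * (eta n k * x)))"
      by (simp add: nabla_eta_mult right_diff_distrib scaleR_2)
  qed
  also have "\<dots> = eta_square n * nabla n x - 2 *\<^sub>R (\<Sum>k<n. \<Sum>j<n. eta n j * (agen k j * (eta n k * x)))"
    by (simp only: sum_subtractf eta_square_def sum_distrib_right mult.assoc scaleR_right.sum)
  also have "(\<Sum>k<n. \<Sum>j<n. eta n j * (agen k j * (eta n k * x))) = 0"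
  proof (rule eq_minus_self)
    have "eta n j * (agen k j * (eta n k * x)) = - (eta n k * (agen j k * (eta n j * x)))" for j k
      using agen_skew[of j k]
      by (simp add: eta_commute[of "agen k j" n k x] eta_commute[of "agen k j" n j x]
          eta_commute[of "eta n j" n k "agen k j * x"])
    then have "(\<Sum>k<n. \<Sum>j<n. eta n j * (agen k j * (eta n k * x)))
        = - (\<Sum>k<n. \<Sum>j<n. eta n k * (agen j k * (eta n j * x)))"
      unfolding sum_negf[symmetric] by (intro sum.cong refl)
    also have "(\<Sum>k<n. \<Sum>j<n. eta n k * (agen j k * (eta n j * x)))
        = (\<Sum>k<n. \<Sum>j<n. eta n j * (agen k j * (eta n k * x)))"
      by (rule sum.swap)
    finally show "(\<Sum>k<n. \<Sum>j<n. eta n j * (agen k j * (eta n k * x)))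
        = - (\<Sum>k<n. \<Sum>j<n. eta n j * (agen k j * (eta n k * x)))" .
  qed
  finally show ?thesis by simp
qed

lemma nabla_eta_square_pow: "nabla n (eta_square n ^ r) = 0"
  by (induction r) (simp_all add: nabla_one nabla_eta_square_mult)

text \<open>In each product eta_k theta_k, differentiating theta_k gives eta_k^2. Differentiating
  eta_k and summing the a_kj theta_k over k, with skew-symmetry, gives omega_0 a second
  time.\<close>

lemma nabla_eta_theta_mult:
  "nabla n (eta_theta n * x) = 2 *\<^sub>R (eta_square n * x) - eta_theta n * nabla n x"
proof -
  have "nabla n (eta_theta n * x) = (\<Sum>k<n. nabla n (eta n k * (theta k * x)))"
    by (simp add: eta_theta_def sum_distrib_right mult.assoc nabla_sum)
  also have "\<dots> = (\<Sum>k<n. eta n k * (eta n k * x) - eta n k * (theta k * nabla n x)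
      - (\<Sum>j<n. eta n j * (agen k j * (theta k * x))))"
    by (intro sum.cong refl) (simp add: nabla_eta_mult nabla_theta_mult right_diff_distrib)
  also have "\<dots> = eta_square n * x - eta_theta n * nabla n x
      - (\<Sum>k<n. \<Sum>j<n. eta n j * (agen k j * (theta k * x)))"
    by (simp only: sum_subtractf eta_square_def eta_theta_def sum_distrib_right mult.assoc)
  also have "(\<Sum>k<n. \<Sum>j<n. eta n j * (agen k j * (theta k * x))) = - (eta_square n * x)"
  proof -
    have "(\<Sum>k<n. eta n j * (agen k j * (theta k * x))) = - (eta n j * (eta n j * x))" for j
    proof -
      have "(\<Sum>k<n. eta n j * (agen k j * (theta k * x))) = (\<Sum>k<n. - (eta n j * (agen j k * theta k * x)))"
        using agen_skew[of _ j] by (intro sum.cong refl) (metis mult.assoc mult_minus_left mult_minus_right)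
      also have "\<dots> = - (eta n j * (eta n j * x))"
        by (simp only: sum_negf eta_def[of n j] sum_distrib_right sum_distrib_left)
      finally show ?thesis .
    qed
    then show ?thesis
      by (subst sum.swap) (simp add: eta_square_def sum_negf sum_distrib_right mult.assoc)
  qed
  finally show ?thesis by (simp add: scaleR_2)
qed

text \<open>The hypothesis expresses top degree in theta. Then theta_l d_j x is x for l = j and 0
  otherwise, so eta_j d_j x reduces to a_jj x, and A has zero diagonal.\<close>

lemma nabla_eq_zero:
  assumes "\<And>i. i < n \<Longrightarrow> theta i * x = 0"
  shows "nabla n x = 0"
proof -
  have "eta n j * dtheta j x = 0" if "j < n" for j
  proof -
    have "theta l * dtheta j x = (if l = j then x else 0)" if "l < n" for l
      using contract_gen_mult[of "(j, j)" "(l, l)" x] assms[OF that] by (auto split: if_splits)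
    then have "agen j l * theta l * dtheta j x = 0" if "l < n" for l
      using that by (simp add: mult.assoc)
    then show ?thesis by (simp add: eta_def sum_distrib_right)
  qed
  then show ?thesis by (simp add: nabla_def)
qed

text \<open>The element alpha omega_0^q has theta-degree 2q + 2 = n, so nabla kills it; its image is
  twice omega_0^(q+1).\<close>

lemma eta_square_pow_eq_zero:
  assumes "n = 2 * Suc q"
  shows "eta_square n ^ Suc q = 0"
proof -
  have "theta i * (eta_theta n * eta_square n ^ q) = 0" if "i < n" for i
    using theta_degree_ge_theta_mult[OF theta_degree_ge_eta_theta_mult[OF theta_degree_ge_eta_square_pow] that, of q]
    by (rule theta_degree_ge_eq_zero) (simp add: assms)
  from nabla_eq_zero[of n, OF this] show ?thesis
    by (simp add: nabla_eta_theta_mult nabla_eta_square_pow)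
qed

text \<open>The extra factor theta_k lifts the degree to 2q + 3 = n. The two sides are the two terms
  produced by nabla.\<close>

lemma eta_mult_eta_theta_eta_square_pow:
  assumes "n = 2 * Suc q + 1" "k < n"
  shows "eta n k * (eta_theta n * eta_square n ^ q) = 2 *\<^sub>R (theta k * eta_square n ^ Suc q)"
proof -
  have "theta i * (theta k * (eta_theta n * eta_square n ^ q)) = 0" if "i < n" for i
    using theta_degree_ge_theta_mult[OF theta_degree_ge_theta_mult[OF
        theta_degree_ge_eta_theta_mult[OF theta_degree_ge_eta_square_pow] assms(2)] that, of q]
    by (rule theta_degree_ge_eq_zero) (simp add: assms(1))
  from nabla_eq_zero[of n, OF this] show ?thesis
    by (simp add: nabla_theta_mult assms(2) nabla_eta_theta_mult nabla_eta_square_pow)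
qed

section \<open>Powers of omega in terms of omega_0 and alpha\<close>

lemma quad_asq: "quad n (asq n) = (1/2) *\<^sub>R eta_square n"
proof -
  have "eta n j * eta n j = (\<Sum>a<n. \<Sum>b<n. agen a j * agen j b * (theta a * theta b))" for j
  proof -
    have "agen j a * theta a * (agen j b * theta b) = agen a j * agen j b * (theta a * theta b)" for a b
    proof -
      have "theta a * agen j b = - (agen j b * theta a)"
        using gen_mult_commute[of "(a, a)" "agen j b"] by simp
      then have "agen j a * theta a * (agen j b * theta b) = - (agen j a * (agen j b * theta a) * theta b)"
        by (metis mult.assoc mult_minus_left mult_minus_right)
      then show ?thesis
        using agen_skew[of j a] by (simp add: mult.assoc)
    qed
    then show ?thesis
      by (simp add: eta_def sum_product)
  qed
  then have "eta_square n = (\<Sum>j<n. \<Sum>a<n. \<Sum>b<n. agen a j * agen j b * (theta a * theta b))"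
    by (simp add: eta_square_def)
  also have "\<dots> = (\<Sum>a<n. \<Sum>b<n. \<Sum>j<n. agen a j * agen j b * (theta a * theta b))"
    by (subst sum.swap) (intro sum.cong refl sum.swap)
  finally show ?thesis
    by (simp add: quad_def asq_def sum_distrib_right)
qed

lemma eta_theta_eq: "eta_theta n = - (\<Sum>a<n. \<Sum>b<n. agen a b * (theta a * theta b))"
proof -
  have "agen a b * theta b * theta a = - (agen a b * (theta a * theta b))" for a b
    using gen_anticommute[of "(b, b)" "(a, a)"] by (simp add: mult.assoc)
  then show ?thesis
    by (simp add: eta_theta_def eta_def sum_distrib_right sum_negf)
qed

context odd_pair
begin

lemma quad_L: "quad n L = (1/2) *\<^sub>R (eta_square n - e2 * eta_theta n)"
proof -
  have "quad n L = quad n (asq n) + (1/2) *\<^sub>R (e2 * (\<Sum>a<n. \<Sum>b<n. agen a b * (theta a * theta b)))"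
    by (simp add: quad_def L_def distrib_right sum.distrib scaleR_add_right sum_distrib_left mult.assoc)
  then show ?thesis
    by (simp add: quad_asq eta_theta_eq scaleR_diff_right scaleR_add_right)
qed

text \<open>The binomial expansion stops after the linear term: omega_0 is central and
  \<open>e2 * eta_theta n\<close> has square 0.\<close>

lemma eta_square_diff_pow:
  "(eta_square n - e2 * eta_theta n) ^ Suc r
    = eta_square n ^ Suc r - real (Suc r) *\<^sub>R (e2 * (eta_theta n * eta_square n ^ r))"
proof (induction r)
  case (Suc r)
  have comm: "eta_square n * (x * y) = x * (eta_square n * y)" for x y
    using even_over_commute[OF even_over_eta_square, of n x] by (metis mult.assoc)
  have "e2 * eta_theta n * (e2 * x) = 0" for x
  proof -
    have "eta_theta n * e2 = - (e2 * eta_theta n)"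
      using odd_over_commute[OF odd_over_eta_theta, of n e2] grade_inv_e2 by simp
    then have "e2 * eta_theta n * (e2 * x) = - (e2 * e2 * (eta_theta n * x))"
      by (metis mult.assoc mult_minus_left mult_minus_right)
    then show ?thesis by (simp add: e2_e2)
  qed
  then have "(eta_square n - e2 * eta_theta n) ^ Suc (Suc r) =
      eta_square n * eta_square n ^ Suc r - real (Suc r) *\<^sub>R (eta_square n * (e2 * (eta_theta n * eta_square n ^ r)))
      - e2 * eta_theta n * eta_square n ^ Suc r"
    unfolding power_Suc[of "eta_square n - e2 * eta_theta n" "Suc r"] Suc
    by (simp add: left_diff_distrib right_diff_distrib)
  also have "eta_square n * (e2 * (eta_theta n * eta_square n ^ r)) = e2 * (eta_theta n * eta_square n ^ Suc r)"
    by (simp add: comm)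
  finally show ?case
    by (simp add: mult.assoc algebra_simps scaleR_2)
qed simp

lemma theta_mult_quad_L_pow:
  "theta k * quad n L ^ Suc r = (1/2) ^ Suc r *\<^sub>R
    (theta k * eta_square n ^ Suc r + real (Suc r) *\<^sub>R (e2 * (theta k * (eta_theta n * eta_square n ^ r))))"
proof -
  have "theta k * (e2 * x) = - (e2 * (theta k * x))" for x
  proof -
    have "theta k * e2 = - (e2 * theta k)"
      using gen_mult_commute[of "(k, k)" e2] grade_inv_e2 by simp
    then show ?thesis by (metis mult.assoc mult_minus_left)
  qed
  then show ?thesis
    by (simp add: quad_L scaleR_pow eta_square_diff_pow right_diff_distrib del: power_Suc of_nat_Suc)
qed

end

section \<open>The identities\<close>

text \<open>Used to compare coefficients in equations between linear forms in theta; odd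
  coefficients cost a sign when the contraction passes them.\<close>

lemma dtheta_linear_form:
  assumes "c < n"
  shows "(\<And>b. even_over diagonal (f b)) \<Longrightarrow> dtheta c (\<Sum>b<n. f b * theta b) = f c"
    and "(\<And>b. odd_over diagonal (f b)) \<Longrightarrow> dtheta c (\<Sum>b<n. f b * theta b) = - f c"
proof -
  have theta: "dtheta c (theta b) = (if b = c then 1 else 0)" for b
    using contract_gen_mult[of "(c, c)" "(b, b)" 1] by simp
  assume f: "even_over diagonal (f b)" for b
  have "dtheta c (f b * theta b) = (if b = c then f c else 0)" for b
    by (simp add: even_over_contract[OF f] theta)
  with assms show "dtheta c (\<Sum>b<n. f b * theta b) = f c"
    by (simp add: contract_sum)
next
  have theta: "dtheta c (theta b) = (if b = c then 1 else 0)" for b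
    using contract_gen_mult[of "(c, c)" "(b, b)" 1] by simp
  assume f: "odd_over diagonal (f b)" for b
  have "dtheta c (f b * theta b) = (if b = c then - f c else 0)" for b
    by (simp add: odd_over_contract[OF f] theta)
  with assms show "dtheta c (\<Sum>b<n. f b * theta b) = - f c"
    by (simp add: contract_sum)
qed

lemma (in odd_pair) C_even: "even_over diagonal (C r i j)"
proof -
  have "even_over diagonal (apow n k i j)" if "even k" for k
    by (rule even_over_subset[OF even_over_apow[OF that] diagonal_nonupper])
  then have "even_over diagonal (apow n (4 * r) i j)" "even_over diagonal (apow n (4 * r - 2) i j)"
    by simp_all
  moreover have "odd_over diagonal (dmat n r i j)"
    by (rule odd_over_subset[OF odd_over_dmat diagonal_nonupper])
  ultimately show ?thesis
    unfolding C_def using E_odd e2_e1_even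
    by (intro even_over_diff even_over_add even_over_scaleR even_over_mult[OF e2_e1_even] odd_over_mult_odd)
qed

text \<open>The choice e2 = 0 leaves L = A^2 unperturbed. It serves the even case, and in the odd
  case it provides the part free of e2.\<close>

lemma odd_pair_gen_0: "odd_pair (gen (2, 0)) 0"
  by unfold_locales (auto intro!: odd_over_gen)

lemma odd_pair_gen_gen: "odd_pair (gen (2, 0)) (gen (3, 0))"
  by unfold_locales (auto intro!: odd_over_gen gen_anticommute)

lemma contract_gen_mult_self:
  "contract p x = 0 \<Longrightarrow> contract p (gen p * x) = x"
  by (simp add: contract_gen_mult)

text \<open>Here q = m - 1, K = A^2 + e1 A and L = A^2.\<close>

lemma identity_even:
  assumes n: "n = 2 * Suc q" and ij: "i < n" "j < n"
  shows "real (2 * q) *\<^sub>R apow n (4 * q + 1) i j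
    = (\<Sum>k<q. atrace n (4 * k + 3) * apow n (4 * (q - 1 - k) + 2) i j)"
proof -
  let ?e = "gen (2, 0)"
  interpret odd_pair n ?e 0 by (rule odd_pair_gen_0)
  have "quad n L ^ Suc q = 0"
    by (simp add: quad_L scaleR_pow eta_square_pow_eq_zero[OF n, unfolded power_Suc])
  \<comment> \<open>Contracting omega^(q+1) = 0 with theta_j leaves multiples of theta_b omega^q, on
    which kappa^q is known. The coefficients of the resulting linear form are the entries of L W_q
    up to order and sign.\<close>
  then have "0 = (dquad n K ^^ q) (dtheta j (quad n L ^ Suc q))"
    by simp
  also have "\<dots> = real (Suc q) *\<^sub>R (\<Sum>b<n. L j b * (dquad n K ^^ q) (theta b * quad n L ^ q))"
    by (simp only: dtheta_quad_pow[OF ij(2)] dquad_pow_linear dquad_pow_sum dquad_pow_even_mult[OF L_even])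
  also have "(\<Sum>b<n. L j b * (dquad n K ^^ q) (theta b * quad n L ^ q))
      = (\<Sum>b<n. L j b * ((fact q)\<^sup>2 *\<^sub>R (\<Sum>c<n. faddeev n LK q c b * theta c)))"
    by (intro sum.cong refl) (simp only: lessThan_iff dquad_pow_theta_quad_pow)
  also have "\<dots> = (fact q)\<^sup>2 *\<^sub>R (\<Sum>c<n. (\<Sum>b<n. L j b * faddeev n LK q c b) * theta c)"
    unfolding mult_scaleR_right scaleR_right.sum[symmetric] sum_distrib_left sum_distrib_right mult.assoc
    by (subst sum.swap) (rule refl)
  finally have "(\<Sum>c<n. (\<Sum>b<n. L j b * faddeev n LK q c b) * theta c) = 0"
    by simp
  then have "dtheta i (\<Sum>c<n. (\<Sum>b<n. L j b * faddeev n LK q c b) * theta c) = 0"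
    by simp
  then have "(\<Sum>b<n. L j b * faddeev n LK q i b) = 0"
    by (subst (asm) dtheta_linear_form(1)[OF ij(1)])
      (auto intro!: even_over_sum even_over_mult L_even even_over_faddeev LK_even)
  moreover have "L j b * faddeev n LK q i b = - ((-1) ^ q *\<^sub>R (C q i b * apow n 2 b j))" if "b < n" for b
  proof -
    have "L j b = - apow n 2 b j"
      using asq_skew[of n j b] that by (simp add: L_def asq_eq_apow)
    moreover have "even_over nonupper (apow n 2 b j)"
      by (rule even_over_apow) simp
    ultimately show ?thesis
      using even_over_commute[of nonupper "apow n 2 b j" "C q i b"]
      by (simp add: faddeev_LK[OF ij(1) that] del: apow.simps)
  qed
  then have "(\<Sum>b<n. L j b * faddeev n LK q i b) = (\<Sum>b<n. - ((-1) ^ q *\<^sub>R (C q i b * apow n 2 b j)))"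
    by (intro sum.cong refl) (simp only: lessThan_iff)
  ultimately have "(\<Sum>b<n. C q i b * apow n 2 b j) = 0"
    by (simp add: sum_negf flip: scaleR_right.sum)
  moreover have "C q i b = apow n (4 * q) i b + ?e * dmat n q i b" for b
    by (simp add: C_def E_def)
  ultimately have "apow n (4 * q + 2) i j + ?e * (\<Sum>b<n. dmat n q i b * apow n 2 b j) = 0"
    by (simp only: distrib_right sum.distrib sum_distrib_left apow_add[OF ij(2)] mult.assoc)
  \<comment> \<open>Extracts the e1-coefficient; powers of A do not contain
    \<open>?e\<close>.\<close>
  then have "contract (2, 0) (apow n (4 * q + 2) i j + ?e * (\<Sum>b<n. dmat n q i b * apow n 2 b j)) = 0"
    by (simp only: contract_linear)
  moreover have "odd_over nonupper (\<Sum>b<n. dmat n q i b * apow n 2 b j)"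
    by (intro odd_over_sum odd_over_mult_even odd_over_dmat even_over_apow) simp
  ultimately have zero: "(\<Sum>b<n. dmat n q i b * apow n 2 b j) = 0"
    by (simp add: contract_apow contract_gen_mult_self odd_over_contract_self del: apow.simps)
  have "(\<Sum>b<n. dmat n q i b * apow n 2 b j) = real q *\<^sub>R apow n (4 * q + 1) i j
    - (1/2) *\<^sub>R (\<Sum>k<q. atrace n (4 * k + 3) * apow n (4 * (q - 1 - k) + 2) i j)"
  proof -
    have "real q *\<^sub>R apow n (4 * q - 1 + 2) i j = real q *\<^sub>R apow n (4 * q + 1) i j"
    \<comment> \<open>For q = 0 the truncated exponent is wrong, but its coefficient is 0.\<close>
    proof (cases q)
      case (Suc s)
      then have "4 * q - 1 + 2 = 4 * q + 1" by simp
      then show ?thesis by (simp only:)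
    qed simp
    moreover have "(\<Sum>b<n. dmat n q i b * apow n 2 b j) = real q *\<^sub>R apow n (4 * q - 1 + 2) i j
      - (1/2) *\<^sub>R (\<Sum>b<n. \<Sum>k<q. atrace n (4 * k + 3) * (apow n (4 * (q - 1 - k)) i b * apow n 2 b j))"
      by (simp only: dmat_def left_diff_distrib sum_subtractf scaleR_right.sum sum_distrib_right mult.assoc
          mult_scaleR_left apow_add[OF ij(2)])
    moreover have "(\<Sum>b<n. \<Sum>k<q. atrace n (4 * k + 3) * (apow n (4 * (q - 1 - k)) i b * apow n 2 b j))
        = (\<Sum>k<q. atrace n (4 * k + 3) * apow n (4 * (q - 1 - k) + 2) i j)"
      by (subst sum.swap) (simp only: apow_add[OF ij(2)] flip: sum_distrib_left)
    ultimately show ?thesis by (simp only:)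
  qed
  from trans[OF sym[OF this] zero] have "real q *\<^sub>R apow n (4 * q + 1) i j
    = (1/2) *\<^sub>R (\<Sum>k<q. atrace n (4 * k + 3) * apow n (4 * (q - 1 - k) + 2) i j)"
    by (rule iffD1[OF right_minus_eq])
  then have "2 *\<^sub>R (real q *\<^sub>R apow n (4 * q + 1) i j)
    = 2 *\<^sub>R ((1/2) *\<^sub>R (\<Sum>k<q. atrace n (4 * k + 3) * apow n (4 * (q - 1 - k) + 2) i j))"
    by (simp only:)
  moreover have "real (2 * q) *\<^sub>R x = 2 *\<^sub>R (real q *\<^sub>R x)" "2 *\<^sub>R ((1/2) *\<^sub>R x) = x" for x :: grassmann
    by simp_all
  ultimately show ?thesis
    by (simp only:)
qed

text \<open>Here q = m - 1. The linear form m e2 (2 kappa^m (theta_j omega_0^m)) is evaluated twice: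
  directly, and through eta_j alpha omega_0^q. The coefficient of e1 e2 theta_i gives the
  identity.\<close>

lemma identity_odd:
  assumes n: "n = 2 * Suc q + 1" and ij: "i < n" "j < n"
  shows "real n *\<^sub>R apow n (4 * q + 3) i j
    = (\<Sum>k<Suc q. atrace n (4 * k + 3) * apow n (4 * (q - k)) i j)"
proof -
  let ?e1 = "gen (2, 0)" and ?e2 = "gen (3, 0)" and ?m = "Suc q"
  interpret X: odd_pair n ?e1 0 by (rule odd_pair_gen_0)
  \<comment> \<open>Both instances have the same e1, hence the same K, so a single operator kappa
    serves both.\<close>
  interpret Y: odd_pair n ?e1 ?e2 by (rule odd_pair_gen_gen)
  let ?\<kappa> = "dquad n Y.K ^^ ?m"
  define Z where "Z k = ?\<kappa> (theta k * eta_square n ^ ?m)" for k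
  define U where "U k = ?\<kappa> (theta k * (eta_theta n * eta_square n ^ q))" for k
  \<comment> \<open>Collects 2^m from the halves in omega^m, the squared factorial from
    \<open>dquad_pow_theta_quad_pow\<close> and the sign from \<open>faddeev_LK\<close>.\<close>
  define N :: real where "N = 2 ^ ?m * (fact ?m)\<^sup>2 * (-1) ^ ?m"
  have N: "N \<noteq> 0" by (simp add: N_def)
  have cancel: "x + p = s" if "d = - p" "d = x - s" for x p s d :: grassmann
  proof -
    have "x + p = (x - s) + p + s" by simp
    also have "x - s = - p" using that by (simp only:)
    finally show ?thesis by simp
  qed
  have unscale: "x = N *\<^sub>R y" if "(1/2) ^ ?m *\<^sub>R x = (fact ?m)\<^sup>2 *\<^sub>R ((-1) ^ ?m *\<^sub>R y)" for x y :: grassmann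
  proof -
    have "(2 ^ ?m) *\<^sub>R ((1/2) ^ ?m *\<^sub>R x) = (2 ^ ?m) *\<^sub>R ((fact ?m)\<^sup>2 *\<^sub>R ((-1) ^ ?m *\<^sub>R y))"
      using that by (simp only:)
    then show ?thesis
      by (simp add: N_def power_one_over del: power_Suc fact_Suc)
  qed
  have e2_odd: "odd_over diagonal ?e2" by (rule Y.e2_odd)
  have Z: "Z k = N *\<^sub>R (\<Sum>c<n. X.C ?m c k * theta c)" if "k < n" for k
  proof (rule unscale)
    have "(1/2) ^ ?m *\<^sub>R Z k = ?\<kappa> (theta k * quad n X.L ^ ?m)"
      by (simp only: X.theta_mult_quad_L_pow mult_zero_left scaleR_zero_right add_0_right dquad_pow_linear Z_def)
    also have "\<dots> = (fact ?m)\<^sup>2 *\<^sub>R (\<Sum>c<n. faddeev n X.LK ?m c k * theta c)"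
      by (rule X.dquad_pow_theta_quad_pow[OF that])
    also have "(\<Sum>c<n. faddeev n X.LK ?m c k * theta c) = (\<Sum>c<n. (-1) ^ ?m *\<^sub>R X.C ?m c k * theta c)"
      using that by (intro sum.cong refl) (simp only: lessThan_iff X.faddeev_LK)
    finally show "(1/2) ^ ?m *\<^sub>R Z k = (fact ?m)\<^sup>2 *\<^sub>R ((-1) ^ ?m *\<^sub>R (\<Sum>c<n. X.C ?m c k * theta c))"
      by (simp only: scaleR_right.sum mult_scaleR_left)
  qed
  have ZU: "Z k + real ?m *\<^sub>R (?e2 * U k) = N *\<^sub>R (\<Sum>c<n. Y.C ?m c k * theta c)" if "k < n" for k
  proof (rule unscale)
    have "(1/2) ^ ?m *\<^sub>R (Z k + real ?m *\<^sub>R (?e2 * U k)) = ?\<kappa> (theta k * quad n Y.L ^ ?m)"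
      unfolding Y.theta_mult_quad_L_pow dquad_pow_linear Y.dquad_pow_odd_mult[OF e2_odd] Z_def U_def ..
    also have "\<dots> = (fact ?m)\<^sup>2 *\<^sub>R (\<Sum>c<n. faddeev n Y.LK ?m c k * theta c)"
      by (rule Y.dquad_pow_theta_quad_pow[OF that])
    also have "(\<Sum>c<n. faddeev n Y.LK ?m c k * theta c) = (\<Sum>c<n. (-1) ^ ?m *\<^sub>R Y.C ?m c k * theta c)"
      using that by (intro sum.cong refl) (simp only: lessThan_iff Y.faddeev_LK)
    finally show "(1/2) ^ ?m *\<^sub>R (Z k + real ?m *\<^sub>R (?e2 * U k))
        = (fact ?m)\<^sup>2 *\<^sub>R ((-1) ^ ?m *\<^sub>R (\<Sum>c<n. Y.C ?m c k * theta c))"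
      by (simp only: scaleR_right.sum mult_scaleR_left)
  qed
  \<comment> \<open>The e2-coefficient of \<open>Y.C\<close>.\<close>
  define X where "X c l = dmat n ?m c l - real ?m *\<^sub>R (?e1 * apow n (4 * ?m - 2) c l)" for c l
  have YX: "Y.C ?m c l = X.C ?m c l + ?e2 * X c l" for c l
    by (simp add: Y.C_def X.C_def Y.E_def X.E_def X_def algebra_simps del: apow.simps of_nat_Suc)
  \<comment> \<open>Subtracting \<open>Z\<close> from \<open>ZU\<close> isolates the part with e2.
    That factor is carried along and removed by a contraction once the theta are gone.\<close>
  have U: "real ?m *\<^sub>R (?e2 * U l) = N *\<^sub>R (\<Sum>c<n. ?e2 * X c l * theta c)" if "l < n" for l
    using ZU[OF that] unfolding Z[OF that] YX distrib_right sum.distrib scaleR_add_right by simp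
  \<comment> \<open>kappa^m is applied to the top-degree relation; the odd entries a_jl pass through
    it without sign.\<close>
  have a_U: "(\<Sum>l<n. agen j l * U l) = 2 *\<^sub>R Z j"
  proof -
    have "?\<kappa> (eta n j * (eta_theta n * eta_square n ^ q)) = ?\<kappa> (2 *\<^sub>R (theta j * eta_square n ^ ?m))"
      by (simp only: eta_mult_eta_theta_eta_square_pow[OF n ij(2)])
    then show ?thesis
      unfolding eta_def sum_distrib_right mult.assoc dquad_pow_sum dquad_pow_linear
        Y.dquad_pow_odd_mult[OF odd_over_agen_diagonal] U_def Z_def .
  qed
  have e2_agen: "?e2 * (agen j l * x) = - (agen j l * (?e2 * x))" for l x
  proof -
    have "?e2 * agen j l = - (agen j l * ?e2)"
      using gen_mult_commute[of "(3, 0)" "agen j l"] by simp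
    then show ?thesis by (metis mult.assoc mult_minus_left)
  qed
  have "(\<Sum>c<n. (2 * real ?m) *\<^sub>R (?e2 * X.C ?m c j) * theta c)
      = (\<Sum>c<n. - (\<Sum>l<n. agen j l * (?e2 * X c l)) * theta c)"
  proof -
    have "N *\<^sub>R (\<Sum>c<n. (2 * real ?m) *\<^sub>R (?e2 * X.C ?m c j) * theta c)
        = real ?m *\<^sub>R (?e2 * (2 *\<^sub>R Z j))"
      by (simp add: Z[OF ij(2)] sum_distrib_left scaleR_right.sum mult_ac del: of_nat_Suc)
    also have "\<dots> = (\<Sum>l<n. - (agen j l * (real ?m *\<^sub>R (?e2 * U l))))"
      unfolding a_U[symmetric] by (simp add: sum_distrib_left scaleR_right.sum e2_agen del: of_nat_Suc)
    also have "\<dots> = (\<Sum>l<n. - (agen j l * (N *\<^sub>R (\<Sum>c<n. ?e2 * X c l * theta c))))"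
      by (intro sum.cong refl) (simp only: lessThan_iff U)
    also have "\<dots> = N *\<^sub>R (\<Sum>l<n. \<Sum>c<n. - (agen j l * (?e2 * X c l) * theta c))"
      by (simp add: sum_distrib_left scaleR_right.sum sum_negf mult.assoc)
    also have "(\<Sum>l<n. \<Sum>c<n. - (agen j l * (?e2 * X c l) * theta c))
        = (\<Sum>c<n. - (\<Sum>l<n. agen j l * (?e2 * X c l)) * theta c)"
      by (subst sum.swap) (simp add: sum_distrib_right sum_negf)
    finally show ?thesis using N by simp
  qed
  \<comment> \<open>Compares the coefficients of theta_i.\<close>
  then have "dtheta i (\<Sum>c<n. (2 * real ?m) *\<^sub>R (?e2 * X.C ?m c j) * theta c)
      = dtheta i (\<Sum>c<n. - (\<Sum>l<n. agen j l * (?e2 * X c l)) * theta c)"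
    by (simp only:)
  moreover have "odd_over diagonal ((2 * real ?m) *\<^sub>R (?e2 * X.C ?m c j))" for c
    by (intro odd_over_scaleR odd_over_mult_even e2_odd X.C_even)
  moreover have "odd_over diagonal (- (\<Sum>l<n. agen j l * (?e2 * X c l)))" for c
    unfolding X_def
    by (intro odd_over_minus odd_over_sum odd_over_mult_even odd_over_mult_odd odd_over_diff odd_over_scaleR e2_odd
        X.e1_odd odd_over_agen_diagonal odd_over_subset[OF odd_over_dmat] even_over_subset[OF even_over_apow]) auto
  ultimately have *: "(2 * real ?m) *\<^sub>R (?e2 * X.C ?m i j) = - (\<Sum>l<n. agen j l * (?e2 * X i l))"
    by (simp only: dtheta_linear_form(2)[OF ij(1)] neg_equal_iff_equal)
  have C_eq: "X.C ?m i j = apow n (4 * ?m) i j + ?e1 * dmat n ?m i j"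
    by (simp add: X.C_def X.E_def)
  have dmat_contract: "contract p (dmat n r i l) = 0" if "p \<in> nonupper" for p r l
    by (rule odd_over_contract_self[OF odd_over_dmat that])
  have C_contract: "contract (3, 0) (X.C ?m i j) = 0"
    by (simp add: C_eq contract_gen_mult contract_apow dmat_contract del: apow.simps)
  have X_contract: "contract (3, 0) (X i l) = 0" for l
    by (simp add: X_def contract_gen_mult contract_apow dmat_contract del: apow.simps)
  have agen_contract: "contract p (agen j l * x) = - (agen j l * contract p x)" if "p \<in> nonupper" for l x p
    using odd_over_contract[OF odd_over_agen that] .
  have "contract (3, 0) ((2 * real ?m) *\<^sub>R (?e2 * X.C ?m i j))
      = contract (3, 0) (- (\<Sum>l<n. agen j l * (?e2 * X i l)))"
    using * by (simp only:)
  then have "(2 * real ?m) *\<^sub>R X.C ?m i j = (\<Sum>l<n. agen j l * X i l)"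
    by (simp add: contract_gen_mult_self C_contract X_contract contract_sum agen_contract sum_negf del: of_nat_Suc)
  \<comment> \<open>With e2 removed, the e1-coefficient is taken: it is the \<open>dmat\<close> part
    of \<open>X.C\<close> on the left and the A^(4m-2) part of \<open>X\<close> on the
    right.\<close>
  then have "contract (2, 0) ((2 * real ?m) *\<^sub>R X.C ?m i j) = contract (2, 0) (\<Sum>l<n. agen j l * X i l)"
    by (simp only:)
  moreover have "contract (2, 0) (X.C ?m i j) = dmat n ?m i j"
    by (simp add: C_eq contract_gen_mult contract_apow dmat_contract del: apow.simps)
  moreover have "contract (2, 0) (X i l) = - (real ?m *\<^sub>R apow n (4 * ?m - 2) i l)" for l
    by (simp add: X_def contract_gen_mult contract_apow dmat_contract del: apow.simps of_nat_Suc)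
  ultimately have "real ?m *\<^sub>R (2 *\<^sub>R dmat n ?m i j) = real ?m *\<^sub>R (\<Sum>l<n. agen j l * apow n (4 * ?m - 2) i l)"
    by (simp add: contract_sum agen_contract sum_negf scaleR_right.sum mult.commute[of "real ?m"] del: of_nat_Suc apow.simps)
  then have "2 *\<^sub>R dmat n ?m i j = (\<Sum>l<n. agen j l * apow n (4 * ?m - 2) i l)"
    by (simp only: scaleR_cancel_left of_nat_eq_0_iff nat.distinct simp_thms)
  also have "\<dots> = - (\<Sum>l<n. apow n (4 * ?m - 2) i l * agen l j)"
  proof -
    have "even_over nonupper (apow n (4 * ?m - 2) i l)" for l
      by (rule even_over_apow) simp
    then have "agen j l * apow n (4 * ?m - 2) i l = - (apow n (4 * ?m - 2) i l * agen l j)" for l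
      using even_over_commute[of nonupper "apow n (4 * ?m - 2) i l" "agen j l"] agen_skew[of l j]
      by (simp only: mult_minus_right minus_minus)
    then show ?thesis by (simp only: sum_negf)
  qed
  also have "(\<Sum>l<n. apow n (4 * ?m - 2) i l * agen l j) = apow n (Suc (4 * ?m - 2)) i j"
    by (simp only: apow.simps)
  also have "Suc (4 * ?m - 2) = 4 * q + 3" by simp
  finally have "2 *\<^sub>R dmat n ?m i j = - apow n (4 * q + 3) i j" .
  moreover have "2 *\<^sub>R dmat n ?m i j = (2 * real ?m) *\<^sub>R apow n (4 * q + 3) i j
     - (\<Sum>k<?m. atrace n (4 * k + 3) * apow n (4 * (q - k)) i j)"
  proof -
    have "4 * ?m - 1 = 4 * q + 3" "?m - 1 - k = q - k" for k by simp_all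
    then show ?thesis
      by (simp only: dmat_def scaleR_diff_right scaleR_scaleR) simp
  qed
  ultimately have "(2 * real ?m) *\<^sub>R apow n (4 * q + 3) i j + apow n (4 * q + 3) i j
      = (\<Sum>k<?m. atrace n (4 * k + 3) * apow n (4 * (q - k)) i j)"
    by (rule cancel)
  \<comment> \<open>The extra copy of A^(4q+3) raises the coefficient from 2m to n.\<close>
  moreover have "real n = 2 * real ?m + 1"
    by (simp add: n)
  ultimately show ?thesis
    by (simp only: scaleR_add_left scaleR_one)
qed

section \<open>Return to the coefficient model\<close>

lemma coeff_sum_ext: "coeff (\<Sum>i\<in>I. f i) = ext_sum (\<lambda>i. coeff (f i)) I"
  by (simp add: ext_sum_def fun_eq_iff coeff_sum)

lemma coeff_agen: "coeff (agen i j) = ext_gen i j"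
  by (auto simp: agen_def ext_gen_def ext_zero_def fun_eq_iff gen.rep_eq)

lemma coeff_apow: "coeff (apow n k i j) = emat_pow n emat_A k i j"
proof (induction k arbitrary: i j)
  case 0
  then show ?case
    by (simp add: emat_id_def zero_grassmann.rep_eq one_grassmann.rep_eq)
next
  case (Suc k)
  then show ?case
    by (simp add: emat_mult_def emat_A_def coeff_sum_ext times_grassmann.rep_eq coeff_agen)
qed

lemma coeff_atrace: "coeff (atrace n k) = emat_trace n (emat_pow n emat_A k)"
  by (simp add: atrace_def emat_trace_def coeff_sum_ext coeff_apow)

lemma coeff_smul: "coeff (real c *\<^sub>R x) = ext_smul (of_nat c) (coeff x)"
  by (simp add: ext_smul_def fun_eq_iff)

lemma ext_diff_eq_zeroI:
  assumes "real c *\<^sub>R apow n d i j = (\<Sum>k\<in>I. atrace n (f k) * apow n (g k) i j)"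
  shows "ext_diff (ext_smul (of_nat c) (emat_pow n emat_A d i j))
      (ext_sum (\<lambda>k. ext_mult (emat_trace n (emat_pow n emat_A (f k))) (emat_pow n emat_A (g k) i j)) I)
    = ext_zero"
proof -
  have "coeff (\<Sum>k\<in>I. atrace n (f k) * apow n (g k) i j)
      = ext_sum (\<lambda>k. ext_mult (emat_trace n (emat_pow n emat_A (f k))) (emat_pow n emat_A (g k) i j)) I"
    by (simp only: coeff_sum_ext times_grassmann.rep_eq coeff_atrace coeff_apow)
  moreover have "coeff (real c *\<^sub>R apow n d i j) = ext_smul (of_nat c) (emat_pow n emat_A d i j)"
    by (simp only: coeff_smul coeff_apow)
  ultimately show ?thesis
    using assms by (simp add: ext_diff_def ext_zero_def)
qed

theorem theorem4p12:
  fixes n m :: nat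
  assumes "n \<ge> 2"
  shows "(n = 2 * m \<longrightarrow>
           (\<forall>i<n. \<forall>j<n.
              ext_diff (ext_smul (of_nat (n - 2)) (emat_pow n emat_A (2 * n - 3) i j))
                (ext_sum (\<lambda>k. ext_mult (emat_trace n (emat_pow n emat_A (4 * k + 3)))
                                        (emat_pow n emat_A (2 * n - 3 - (4 * k + 3)) i j))
                         {k. k + 2 \<le> m}) = ext_zero))
       \<and> (n = 2 * m + 1 \<longrightarrow>
           (\<forall>i<n. \<forall>j<n.
              ext_diff (ext_smul (of_nat n) (emat_pow n emat_A (2 * n - 3) i j))
                (ext_sum (\<lambda>k. ext_mult (emat_trace n (emat_pow n emat_A (4 * k + 3)))
                                        (emat_pow n emat_A (2 * n - 3 - (4 * k + 3)) i j))
                         {k. k + 1 \<le> m}) = ext_zero))"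
proof (intro conjI impI allI)
  fix i j assume n: "n = 2 * m" and ij: "i < n" "j < n"
  obtain q where q: "m = Suc q"
    using assms n by (cases m) auto
  have "real (2 * q) *\<^sub>R apow n (4 * q + 1) i j
      = (\<Sum>k<q. atrace n (4 * k + 3) * apow n (4 * (q - 1 - k) + 2) i j)"
    using n q by (intro identity_even ij) simp
  also have "\<dots> = (\<Sum>k<q. atrace n (4 * k + 3) * apow n (2 * n - 3 - (4 * k + 3)) i j)"
  proof (intro sum.cong refl)
    fix k assume "k \<in> {..<q}"
    \<comment> \<open>For k < q none of the natural-number subtractions truncates.\<close>
    then have "4 * (q - 1 - k) + 2 = 2 * n - 3 - (4 * k + 3)"
      using n q by auto
    then show "atrace n (4 * k + 3) * apow n (4 * (q - 1 - k) + 2) i j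
        = atrace n (4 * k + 3) * apow n (2 * n - 3 - (4 * k + 3)) i j"
      by (simp only:)
  qed
  also have "{..<q} = {k. k + 2 \<le> m}"
    using q by auto
  also have "2 * q = n - 2"
    using n q by simp
  also have "4 * q + 1 = 2 * n - 3"
    using n q by simp
  finally show "ext_diff (ext_smul (of_nat (n - 2)) (emat_pow n emat_A (2 * n - 3) i j))
      (ext_sum (\<lambda>k. ext_mult (emat_trace n (emat_pow n emat_A (4 * k + 3)))
        (emat_pow n emat_A (2 * n - 3 - (4 * k + 3)) i j)) {k. k + 2 \<le> m}) = ext_zero"
    by (rule ext_diff_eq_zeroI)
next
  fix i j assume n: "n = 2 * m + 1" and ij: "i < n" "j < n"
  obtain q where q: "m = Suc q"
    using assms n by (cases m) auto
  have "real n *\<^sub>R apow n (4 * q + 3) i j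
      = (\<Sum>k<Suc q. atrace n (4 * k + 3) * apow n (4 * (q - k)) i j)"
    using n q by (intro identity_odd ij) simp
  also have "\<dots> = (\<Sum>k<Suc q. atrace n (4 * k + 3) * apow n (2 * n - 3 - (4 * k + 3)) i j)"
  proof (intro sum.cong refl)
    fix k assume "k \<in> {..<Suc q}"
    \<comment> \<open>Here 2n - 3 = 4q + 3, and k <= q again keeps the subtractions exact.\<close>
    then have "4 * (q - k) = 2 * n - 3 - (4 * k + 3)"
      using n q by auto
    then show "atrace n (4 * k + 3) * apow n (4 * (q - k)) i j
        = atrace n (4 * k + 3) * apow n (2 * n - 3 - (4 * k + 3)) i j"
      by (simp only:)
  qed
  also have "{..<Suc q} = {k. k + 1 \<le> m}"
    using q by auto
  also have "4 * q + 3 = 2 * n - 3"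
    using n q by simp
  finally show "ext_diff (ext_smul (of_nat n) (emat_pow n emat_A (2 * n - 3) i j))
      (ext_sum (\<lambda>k. ext_mult (emat_trace n (emat_pow n emat_A (4 * k + 3)))
        (emat_pow n emat_A (2 * n - 3 - (4 * k + 3)) i j)) {k. k + 1 \<le> m}) = ext_zero"
    by (rule ext_diff_eq_zeroI)
qed

end
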